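(* Let $\widehat\Sigma$ be a lifted signature over $\mathbf{GMet}$ and $S$ a set of Horn clauses. The assignment $(A,d)\mapsto(\widehat{T}_{\widehat\Sigma,S}A,\widehat{T}_{\widehat\Sigma,S}d)$, with $\widehat{T}_{\widehat\Sigma,S}f([t]_{\equiv_A})=[T_\Sigma f(t)]_{\equiv_B}$ on nonexpansive maps $f:(A,d)\to(B,\Delta)$, together with the unit $\widehat\eta_{(A,d)}(a)=[a]_{\equiv_A}$ and multiplication $\widehat\mu_{(A,d)}\big([t([t_1]_{\equiv_A},\dots,[t_n]_{\equiv_A})]_{\equiv_{\widehat T_{\widehat\Sigma,S}A}}\big)=[t(t_1,\dots,t_n)]_{\equiv_A}$, is a well-defined monad $(\widehat{T}_{\widehat\Sigma,S},\widehat\eta,\widehat\mu)$ on $\mathbf{GMet}$.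
   Context: Generalised metric spaces. A fuzzy relation is $(A,d)$ with $d:A\times A\to[0,1]$; $f:(A,d)\to(B,\Delta)$ is nonexpansive if $\Delta(f(a),f(a'))\le d(a,a')$. Fix a subset $G$ of the axioms (S) $d(a,b)=d(b,a)$, (R) $d(a,a)=0$, (I) $d(a,b)=0\Rightarrow a=b$, (T) $d(a,c)\le d(a,b)+d(b,c)$, (U) $d(a,c)\le\max\{d(a,b),d(b,c)\}$; $\mathbf{GMet}$ is the category of fuzzy relations satisfying $G$ with nonexpansive maps. An isometric embedding is an injective distance-preserving map. Lifted signatures and algebras. A lifting of $(-)^n:\mathbf{Set}\to\mathbf{Set}$ is a functor $L:\mathbf{GMet}\to\mathbf{GMet}$ with $L(A,d)=(A^n,L(d))$, $L(f)=f^n$; it preserves isometric embeddings if $L(f)$ is one whenever $f$ is. A lifted signature $\widehat{\Sigma}$ is a signature $\Sigma$ with a lifting $L_{\mathsf{op}}$ of $(-)^n$ preserving isometric embeddings for each symbol $\mathsf{op}$ of arity $n$. A quantitative $\widehat\Sigma$-algebra is $(A,d)\in\mathbf{GMet}$ with maps $[\![\mathsf{op}]\!]:A^n\to A$ nonexpansive from $(A^n,L_{\mathsf{op}}(d))$ to $(A,d)$. Horn clauses and theories. $X$ is a countable set of variables; (quantitative) equations are $s=t$ and $s=_\varepsilon t$. A Horn clause is $\Gamma\vdash\phi$ with $\Gamma$ a set of (quantitative) equations. A quantitative theory is a set $\vdash$ of Horn clauses closed under Sub ($\Gamma\vdash\phi\Rightarrow\sigma^*(\Gamma)\vdash\sigma^*(\phi)$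 for substitutions $\sigma$), Cut (if $\Gamma\vdash\phi$ for all $\phi\in\Gamma'$ and $\Gamma'\vdash\psi$ then $\Gamma\vdash\psi$), Hyp ($\phi\in\Gamma\Rightarrow\Gamma\vdash\phi$), and containing: $\emptyset\vdash x=x$; $x=y\vdash y=x$; $\{x=y,y=z\}\vdash x=z$; $\{x_i=y_i\}_i\vdash\mathsf{op}(\vec x)=\mathsf{op}(\vec y)$; $\emptyset\vdash x=_1y$; $x=_\varepsilon y\vdash x=_{\varepsilon'}y$ ($\varepsilon'\ge\varepsilon$); $\{x=_{\varepsilon_i}y\}_{i\in I}\vdash x=_{\inf_i\varepsilon_i}y$; $\{x=y,x=_\varepsilon z\}\vdash y=_\varepsilon z$; $\{x=y,z=_\varepsilon x\}\vdash z=_\varepsilon y$; for each axiom in $G$: (S) $x=_\varepsilon y\vdash y=_\varepsilon x$, (R) $\emptyset\vdash x=_0x$, (I) $x=_0y\vdash x=y$, (T) $\{x=_\varepsilon y,y=_{\varepsilon'}z\}\vdash x=_{\varepsilon+\varepsilon'}z$, (U) $\{x=_\varepsilon y,y=_{\varepsilon'}z\}\vdash x=_{\max\{\varepsilon,\varepsilon'\}}z$; and ($L$-NE) for each $\mathsf{op}:n:L_{\mathsf{op}}$, variables $x_1,\dots,x_n,y_1,\dots,y_n$ (not necessarily distinct), and every fuzzy relation $\Delta$ on $V=\{x_1,\dots,y_n\}$ with $(V,\Delta)\in\mathbf{GMet}$, the clause $\{w=_{\Delta(w,z)}z\mid w,z\in V\}\vdash\mathsf{op}(\vec x)=_\delta\mathsf{op}(\vec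 y)$, $\delta=L_{\mathsf{op}}(\Delta)(\vec x,\vec y)$. Term construction. For $(A,d)\in\mathbf{GMet}$, let $\widehat\Sigma_A$ be $\widehat\Sigma$ extended with a fresh constant $a$ for each $a\in A$, with the $0$-ary product lifting (every space is sent to the terminal one-point space $\{*\}$ with $d( *,* )=0$ if (R) $\in G$, else $1$). Identify ground $\Sigma_A$-terms with $T_\Sigma A$. Let $\vdash_{S_A}$ be the smallest quantitative theory over $\widehat\Sigma_A$ containing $S$ and all $\emptyset\vdash a=_{d(a,a')}a'$ ($a,a'\in A$). Set $s\equiv_A t$ iff $(\emptyset\vdash s=t)\in{\vdash_{S_A}}$; $\widehat{T}_{\widehat\Sigma,S}A=T_\Sigma A/{\equiv_A}$; $\widehat{T}_{\widehat\Sigma,S}d([s],[t])=\inf\{\varepsilon\mid(\emptyset\vdash s=_\varepsilon t)\in{\vdash_{S_A}}\}$. $T_\Sigma f$ replaces each $a$ by $f(a)$. In $\widehat\mu$, $t$ is a term over the set $\widehat T_{\widehat\Sigma,S}A$ whose leaves are $[t_1],\dots,[t_n]$, and $t(t_1,\dots,t_n)$ is the flattened term. *)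

theory Defs
  imports Complex_Main "HOL-Library.NList" "HOL-Library.FuncSet" "HOL-Library.Countable_Set"
begin

section \<open>Generalised metric spaces\<close>

datatype gmet_axiom = AxS | AxR | AxI | AxT | AxU

text \<open>Only the values of the distance on the carrier are meaningful.\<close>

type_synonym 'a fuzzy = "'a set \<times> ('a \<Rightarrow> 'a \<Rightarrow> real)"

definition GMet :: "gmet_axiom set \<Rightarrow> 'a fuzzy set" where
  "GMet G = {(A, d).
     (\<forall>a\<in>A. \<forall>b\<in>A. d a b \<in> {0..1}) \<and>
     (AxS \<in> G \<longrightarrow> (\<forall>a\<in>A. \<forall>b\<in>A. d a b = d b a)) \<and>
     (AxR \<in> G \<longrightarrow> (\<forall>a\<in>A. d a a = 0)) \<and>
     (AxI \<in> G \<longrightarrow> (\<forall>a\<in>A. \<forall>b\<in>A. d a b = 0 \<longrightarrow> a = b)) \<and>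
     (AxT \<in> G \<longrightarrow> (\<forall>a\<in>A. \<forall>b\<in>A. \<forall>c\<in>A. d a c \<le> d a b + d b c)) \<and>
     (AxU \<in> G \<longrightarrow> (\<forall>a\<in>A. \<forall>b\<in>A. \<forall>c\<in>A. d a c \<le> max (d a b) (d b c)))}"

definition nonexpansive :: "'a fuzzy \<Rightarrow> 'b fuzzy \<Rightarrow> ('a \<Rightarrow> 'b) \<Rightarrow> bool" where
  "nonexpansive M N f \<longleftrightarrow> f \<in> fst M \<rightarrow> fst N \<and>
     (\<forall>a\<in>fst M. \<forall>a'\<in>fst M. snd N (f a) (f a') \<le> snd M a a')"

definition isometric_embedding :: "'a fuzzy \<Rightarrow> 'b fuzzy \<Rightarrow> ('a \<Rightarrow> 'b) \<Rightarrow> bool" where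
  "isometric_embedding M N f \<longleftrightarrow> f \<in> fst M \<rightarrow> fst N \<and> inj_on f (fst M) \<and>
     (\<forall>a\<in>fst M. \<forall>a'\<in>fst M. snd N (f a) (f a') = snd M a a')"

section \<open>Lifted signatures\<close>

text \<open>A lifting of the \<open>n\<close>-th power functor is given by the distances \<open>l (A, d)\<close> on \<open>A\<^sup>n\<close>. Its
  domain is the category of all spaces carried by subsets of a universe \<open>'u\<close>. The variables of terms
  are taken from \<open>'u\<close>, and theories use \<open>l\<close> only at spaces carried by finite sets of variables, so
  they do not depend on the values of a lifting at spaces outside \<open>'u\<close>. A lifting is a functor as
  soon as it sends nonexpansive maps to nonexpansive maps, since \<open>f \<mapsto> map f\<close> preserves identities
  and composition; in particular \<open>l (A, d)\<close> depends, on \<open>A\<^sup>n\<close>, only on the values of \<open>d\<close> on \<open>A\<close>.\<close>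

definition power_space ::
  "nat \<Rightarrow> ('u fuzzy \<Rightarrow> 'u list \<Rightarrow> 'u list \<Rightarrow> real) \<Rightarrow> 'u fuzzy \<Rightarrow> 'u list fuzzy" where
  "power_space n l M = (nlists n (fst M), l M)"

definition is_lifting ::
  "gmet_axiom set \<Rightarrow> nat \<Rightarrow> ('u fuzzy \<Rightarrow> 'u list \<Rightarrow> 'u list \<Rightarrow> real) \<Rightarrow> bool" where
  "is_lifting G n l \<longleftrightarrow>
     (\<forall>M\<in>GMet G. power_space n l M \<in> GMet G) \<and>
     (\<forall>M\<in>GMet G. \<forall>N\<in>GMet G. \<forall>f. nonexpansive M N f \<longrightarrow>
        nonexpansive (power_space n l M) (power_space n l N) (map f))"

definition preserves_isometric_embeddings ::
  "gmet_axiom set \<Rightarrow> nat \<Rightarrow> ('u fuzzy \<Rightarrow> 'u list \<Rightarrow> 'u list \<Rightarrow> real) \<Rightarrow> bool" where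
  "preserves_isometric_embeddings G n l \<longleftrightarrow>
     (\<forall>M\<in>GMet G. \<forall>N\<in>GMet G. \<forall>f. isometric_embedding M N f \<longrightarrow>
        isometric_embedding (power_space n l M) (power_space n l N) (map f))"

record ('op, 'u) lsig =
  symbols :: "'op set"
  arity :: "'op \<Rightarrow> nat"
  lift :: "'op \<Rightarrow> 'u fuzzy \<Rightarrow> 'u list \<Rightarrow> 'u list \<Rightarrow> real"

definition lifted_signature :: "gmet_axiom set \<Rightarrow> ('op, 'u) lsig \<Rightarrow> bool" where
  "lifted_signature G \<Sigma> \<longleftrightarrow> (\<forall>p\<in>symbols \<Sigma>.
     is_lifting G (arity \<Sigma> p) (lift \<Sigma> p) \<and>
     preserves_isometric_embeddings G (arity \<Sigma> p) (lift \<Sigma> p))"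

section \<open>Terms, equations and Horn clauses\<close>

datatype ('op, 'v) tm = Var 'v | Fn 'op "('op, 'v) tm list"

inductive_set terms :: "('op, 'u) lsig \<Rightarrow> 'v set \<Rightarrow> ('op, 'v) tm set"
  for \<Sigma> :: "('op, 'u) lsig" and V :: "'v set" where
  Var: "v \<in> V \<Longrightarrow> Var v \<in> terms \<Sigma> V"
| Fn: "p \<in> symbols \<Sigma> \<Longrightarrow> length ts = arity \<Sigma> p \<Longrightarrow> (\<forall>t\<in>set ts. t \<in> terms \<Sigma> V) \<Longrightarrow>
    Fn p ts \<in> terms \<Sigma> V"

primrec subst :: "('v \<Rightarrow> ('op, 'w) tm) \<Rightarrow> ('op, 'v) tm \<Rightarrow> ('op, 'w) tm" where
  "subst \<sigma> (Var v) = \<sigma> v"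
| "subst \<sigma> (Fn p ts) = Fn p (map (subst \<sigma>) ts)"

text \<open>\<open>Eq s t\<close> is \<open>s = t\<close>, and \<open>QEq \<epsilon> s t\<close> is \<open>s =\<^sub>\<epsilon> t\<close>.\<close>

datatype 't eqn = Eq 't 't | QEq real 't 't

type_synonym 't horn = "'t eqn set \<times> 't eqn"

definition map_horn :: "('s \<Rightarrow> 't) \<Rightarrow> 's horn \<Rightarrow> 't horn" where
  "map_horn h = map_prod (image (map_eqn h)) (map_eqn h)"

definition equations :: "('op, 'u) lsig \<Rightarrow> 'v set \<Rightarrow> ('op, 'v) tm eqn set" where
  "equations \<Sigma> X = {Eq s t | s t. s \<in> terms \<Sigma> X \<and> t \<in> terms \<Sigma> X} \<union>
     {QEq \<epsilon> s t | \<epsilon> s t. \<epsilon> \<in> {0..1} \<and> s \<in> terms \<Sigma> X \<and> t \<in> terms \<Sigma> X}"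

definition horn_clauses :: "('op, 'u) lsig \<Rightarrow> 'v set \<Rightarrow> ('op, 'v) tm horn set" where
  "horn_clauses \<Sigma> X = {(\<Gamma>, \<phi>). \<Gamma> \<subseteq> equations \<Sigma> X \<and> \<phi> \<in> equations \<Sigma> X}"

section \<open>Quantitative theories\<close>

text \<open>Equation indices live in \<open>[0,1]\<close>. Hence in \<open>Tri\<close> only sums at most \<open>1\<close> give an equation, and in
  \<open>Infi\<close> the infimum is the one of the complete lattice \<open>[0,1]\<close>, with value \<open>1\<close> on the empty family;
  adding \<open>1\<close> to the set computes it with the real \<open>Inf\<close>.\<close>

inductive_set basic_clauses ::
  "gmet_axiom set \<Rightarrow> ('op, 'u) lsig \<Rightarrow> 'u set \<Rightarrow> ('op, 'u) tm horn set"
  for G :: "gmet_axiom set" and \<Sigma> :: "('op, 'u) lsig" and X :: "'u set" where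
  Eq_refl: "x \<in> X \<Longrightarrow> ({}, Eq (Var x) (Var x)) \<in> basic_clauses G \<Sigma> X"
| Eq_sym: "x \<in> X \<Longrightarrow> y \<in> X \<Longrightarrow>
    ({Eq (Var x) (Var y)}, Eq (Var y) (Var x)) \<in> basic_clauses G \<Sigma> X"
| Eq_trans: "x \<in> X \<Longrightarrow> y \<in> X \<Longrightarrow> z \<in> X \<Longrightarrow>
    ({Eq (Var x) (Var y), Eq (Var y) (Var z)}, Eq (Var x) (Var z)) \<in> basic_clauses G \<Sigma> X"
| Eq_cong: "p \<in> symbols \<Sigma> \<Longrightarrow> xs \<in> nlists (arity \<Sigma> p) X \<Longrightarrow> ys \<in> nlists (arity \<Sigma> p) X \<Longrightarrow>
    ({Eq (Var (xs ! i)) (Var (ys ! i)) | i. i < arity \<Sigma> p},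
     Eq (Fn p (map Var xs)) (Fn p (map Var ys))) \<in> basic_clauses G \<Sigma> X"
| Top: "x \<in> X \<Longrightarrow> y \<in> X \<Longrightarrow> ({}, QEq 1 (Var x) (Var y)) \<in> basic_clauses G \<Sigma> X"
| Up: "x \<in> X \<Longrightarrow> y \<in> X \<Longrightarrow> \<epsilon> \<in> {0..1} \<Longrightarrow> \<epsilon>' \<in> {0..1} \<Longrightarrow> \<epsilon> \<le> \<epsilon>' \<Longrightarrow>
    ({QEq \<epsilon> (Var x) (Var y)}, QEq \<epsilon>' (Var x) (Var y)) \<in> basic_clauses G \<Sigma> X"
| Infi: "x \<in> X \<Longrightarrow> y \<in> X \<Longrightarrow> E \<subseteq> {0..1} \<Longrightarrow>
    ({QEq \<epsilon> (Var x) (Var y) | \<epsilon>. \<epsilon> \<in> E}, QEq (Inf (insert 1 E)) (Var x) (Var y))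
      \<in> basic_clauses G \<Sigma> X"
| Eq_left: "x \<in> X \<Longrightarrow> y \<in> X \<Longrightarrow> z \<in> X \<Longrightarrow> \<epsilon> \<in> {0..1} \<Longrightarrow>
    ({Eq (Var x) (Var y), QEq \<epsilon> (Var x) (Var z)}, QEq \<epsilon> (Var y) (Var z))
      \<in> basic_clauses G \<Sigma> X"
| Eq_right: "x \<in> X \<Longrightarrow> y \<in> X \<Longrightarrow> z \<in> X \<Longrightarrow> \<epsilon> \<in> {0..1} \<Longrightarrow>
    ({Eq (Var x) (Var y), QEq \<epsilon> (Var z) (Var x)}, QEq \<epsilon> (Var z) (Var y))
      \<in> basic_clauses G \<Sigma> X"
| Sym: "AxS \<in> G \<Longrightarrow> x \<in> X \<Longrightarrow> y \<in> X \<Longrightarrow> \<epsilon> \<in> {0..1} \<Longrightarrow>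
    ({QEq \<epsilon> (Var x) (Var y)}, QEq \<epsilon> (Var y) (Var x)) \<in> basic_clauses G \<Sigma> X"
| Refl: "AxR \<in> G \<Longrightarrow> x \<in> X \<Longrightarrow> ({}, QEq 0 (Var x) (Var x)) \<in> basic_clauses G \<Sigma> X"
| Ident: "AxI \<in> G \<Longrightarrow> x \<in> X \<Longrightarrow> y \<in> X \<Longrightarrow>
    ({QEq 0 (Var x) (Var y)}, Eq (Var x) (Var y)) \<in> basic_clauses G \<Sigma> X"
| Tri: "AxT \<in> G \<Longrightarrow> x \<in> X \<Longrightarrow> y \<in> X \<Longrightarrow> z \<in> X \<Longrightarrow> \<epsilon> \<in> {0..1} \<Longrightarrow> \<epsilon>' \<in> {0..1} \<Longrightarrow> \<epsilon> + \<epsilon>' \<le> 1 \<Longrightarrow>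
    ({QEq \<epsilon> (Var x) (Var y), QEq \<epsilon>' (Var y) (Var z)}, QEq (\<epsilon> + \<epsilon>') (Var x) (Var z))
      \<in> basic_clauses G \<Sigma> X"
| Ultra: "AxU \<in> G \<Longrightarrow> x \<in> X \<Longrightarrow> y \<in> X \<Longrightarrow> z \<in> X \<Longrightarrow> \<epsilon> \<in> {0..1} \<Longrightarrow> \<epsilon>' \<in> {0..1} \<Longrightarrow>
    ({QEq \<epsilon> (Var x) (Var y), QEq \<epsilon>' (Var y) (Var z)}, QEq (max \<epsilon> \<epsilon>') (Var x) (Var z))
      \<in> basic_clauses G \<Sigma> X"
| L_NE: "p \<in> symbols \<Sigma> \<Longrightarrow> xs \<in> nlists (arity \<Sigma> p) X \<Longrightarrow> ys \<in> nlists (arity \<Sigma> p) X \<Longrightarrow>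
    V = set xs \<union> set ys \<Longrightarrow> (V, \<Delta>) \<in> GMet G \<Longrightarrow>
    ({QEq (\<Delta> w z) (Var w) (Var z) | w z. w \<in> V \<and> z \<in> V},
     QEq (lift \<Sigma> p (V, \<Delta>) xs ys) (Fn p (map Var xs)) (Fn p (map Var ys)))
      \<in> basic_clauses G \<Sigma> X"

definition quantitative_theory ::
  "gmet_axiom set \<Rightarrow> ('op, 'u) lsig \<Rightarrow> 'u set \<Rightarrow> ('op, 'u) tm horn set \<Rightarrow> bool" where
  "quantitative_theory G \<Sigma> X Th \<longleftrightarrow>
     Th \<subseteq> horn_clauses \<Sigma> X \<and>
     basic_clauses G \<Sigma> X \<subseteq> Th \<and>
     (\<forall>c \<sigma>. c \<in> Th \<and> \<sigma> \<in> X \<rightarrow> terms \<Sigma> X \<longrightarrow> map_horn (subst \<sigma>) c \<in> Th) \<and>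
     (\<forall>\<Gamma> \<Gamma>' \<psi>. \<Gamma> \<subseteq> equations \<Sigma> X \<and> (\<forall>\<phi>\<in>\<Gamma>'. (\<Gamma>, \<phi>) \<in> Th) \<and> (\<Gamma>', \<psi>) \<in> Th \<longrightarrow>
        (\<Gamma>, \<psi>) \<in> Th) \<and>
     (\<forall>\<Gamma> \<phi>. \<Gamma> \<subseteq> equations \<Sigma> X \<and> \<phi> \<in> \<Gamma> \<longrightarrow> (\<Gamma>, \<phi>) \<in> Th)"

definition least_theory ::
  "gmet_axiom set \<Rightarrow> ('op, 'u) lsig \<Rightarrow> 'u set \<Rightarrow> ('op, 'u) tm horn set \<Rightarrow> ('op, 'u) tm horn set" where
  "least_theory G \<Sigma> X S = \<Inter>{Th. quantitative_theory G \<Sigma> X Th \<and> S \<subseteq> Th}"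

section \<open>The term construction\<close>

definition add_constants ::
  "gmet_axiom set \<Rightarrow> ('op, 'u) lsig \<Rightarrow> 'a set \<Rightarrow> ('op + 'a, 'u) lsig" where
  "add_constants G \<Sigma> A =
     \<lparr>symbols = symbols \<Sigma> <+> A,
      arity = case_sum (arity \<Sigma>) (\<lambda>_. 0),
      lift = case_sum (lift \<Sigma>) (\<lambda>_ _ _ _. if AxR \<in> G then 0 else 1)\<rparr>"

text \<open>The identification of \<open>T\<^sub>\<Sigma> A\<close>, that is \<open>terms \<Sigma> A\<close>, with the ground terms of the extended
  signature.\<close>

primrec ground :: "('op, 'a) tm \<Rightarrow> ('op + 'a, 'u) tm" where
  "ground (Var a) = Fn (Inr a) []"
| "ground (Fn p ts) = Fn (Inl p) (map ground ts)"

definition theory_of ::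
  "gmet_axiom set \<Rightarrow> ('op, 'u) lsig \<Rightarrow> 'u set \<Rightarrow> ('op, 'u) tm horn set \<Rightarrow> 'a fuzzy \<Rightarrow>
     ('op + 'a, 'u) tm horn set" where
  "theory_of G \<Sigma> X S M = least_theory G (add_constants G \<Sigma> (fst M)) X
     (map_horn (map_tm Inl id) ` S \<union>
      {({}, QEq (snd M a a') (Fn (Inr a) []) (Fn (Inr a') [])) | a a'. a \<in> fst M \<and> a' \<in> fst M})"

definition term_equiv ::
  "gmet_axiom set \<Rightarrow> ('op, 'u) lsig \<Rightarrow> 'u set \<Rightarrow> ('op, 'u) tm horn set \<Rightarrow> 'a fuzzy \<Rightarrow>
     ('op, 'a) tm rel" where
  "term_equiv G \<Sigma> X S M = {(s, t). s \<in> terms \<Sigma> (fst M) \<and> t \<in> terms \<Sigma> (fst M) \<and>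
     ({}, Eq (ground s) (ground t)) \<in> theory_of G \<Sigma> X S M}"

definition term_class ::
  "gmet_axiom set \<Rightarrow> ('op, 'u) lsig \<Rightarrow> 'u set \<Rightarrow> ('op, 'u) tm horn set \<Rightarrow> 'a fuzzy \<Rightarrow>
     ('op, 'a) tm \<Rightarrow> ('op, 'a) tm set" where
  "term_class G \<Sigma> X S M t = term_equiv G \<Sigma> X S M `` {t}"

definition term_dist ::
  "gmet_axiom set \<Rightarrow> ('op, 'u) lsig \<Rightarrow> 'u set \<Rightarrow> ('op, 'u) tm horn set \<Rightarrow> 'a fuzzy \<Rightarrow>
     ('op, 'a) tm \<Rightarrow> ('op, 'a) tm \<Rightarrow> real" where
  "term_dist G \<Sigma> X S M s t =
     Inf {\<epsilon>. ({}, QEq \<epsilon> (ground s) (ground t)) \<in> theory_of G \<Sigma> X S M}"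

text \<open>Operations on classes are defined by \<open>the_elem\<close> of the set of all values obtained from
  representatives; that this set is a singleton is the well-definedness to be proved.\<close>

definition T_obj ::
  "gmet_axiom set \<Rightarrow> ('op, 'u) lsig \<Rightarrow> 'u set \<Rightarrow> ('op, 'u) tm horn set \<Rightarrow> 'a fuzzy \<Rightarrow>
     ('op, 'a) tm set fuzzy" where
  "T_obj G \<Sigma> X S M = (terms \<Sigma> (fst M) // term_equiv G \<Sigma> X S M,
     \<lambda>P Q. the_elem {term_dist G \<Sigma> X S M s t | s t. s \<in> P \<and> t \<in> Q})"

text \<open>For \<open>T_map\<close> the space argument is the codomain of \<open>f\<close>.\<close>

definition T_map ::
  "gmet_axiom set \<Rightarrow> ('op, 'u) lsig \<Rightarrow> 'u set \<Rightarrow> ('op, 'u) tm horn set \<Rightarrow> 'b fuzzy \<Rightarrow>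
     ('a \<Rightarrow> 'b) \<Rightarrow> ('op, 'a) tm set \<Rightarrow> ('op, 'b) tm set" where
  "T_map G \<Sigma> X S N f P = the_elem {term_class G \<Sigma> X S N (map_tm id f t) | t. t \<in> P}"

definition T_unit ::
  "gmet_axiom set \<Rightarrow> ('op, 'u) lsig \<Rightarrow> 'u set \<Rightarrow> ('op, 'u) tm horn set \<Rightarrow> 'a fuzzy \<Rightarrow>
     'a \<Rightarrow> ('op, 'a) tm set" where
  "T_unit G \<Sigma> X S M a = term_class G \<Sigma> X S M (Var a)"

text \<open>A term of terms \<open>u\<close> with leaves \<open>t\<^sub>1, \<dots>, t\<^sub>n\<close> records a choice of representatives in the term
  \<open>t([t\<^sub>1], \<dots>, [t\<^sub>n])\<close>, obtained by applying \<open>term_class\<close> to the leaves; \<open>subst id u\<close> is the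
  flattened term \<open>t(t\<^sub>1, \<dots>, t\<^sub>n)\<close>.\<close>

definition T_mult ::
  "gmet_axiom set \<Rightarrow> ('op, 'u) lsig \<Rightarrow> 'u set \<Rightarrow> ('op, 'u) tm horn set \<Rightarrow> 'a fuzzy \<Rightarrow>
     ('op, ('op, 'a) tm set) tm set \<Rightarrow> ('op, 'a) tm set" where
  "T_mult G \<Sigma> X S M P = the_elem {term_class G \<Sigma> X S M (subst id u) | u.
     u \<in> terms \<Sigma> (terms \<Sigma> (fst M)) \<and> map_tm id (term_class G \<Sigma> X S M) u \<in> P}"

end

theory Submission
  imports Defs
begin

text \<open>Everything rests on one translation property. Let \<open>k\<close> send the points of a space \<open>M\<close> to terms
  over a space \<open>N\<close> such that \<open>k a =\<^sub>\<epsilon> k a'\<close> is provable over \<open>N\<close> for \<open>\<epsilon> = d(a, a')\<close>. Replacing the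
  constants \<open>a\<close> by \<open>k a\<close> then sends provable clauses over \<open>M\<close> to provable clauses over \<open>N\<close>. For
  \<open>k a = f a\<close> with \<open>f\<close> nonexpansive this gives the functor. For \<open>k\<close> choosing a representative of
  each class it gives the multiplication: the infimum defining the distance of two classes is
  attained, so \<open>k\<close> qualifies, and by congruence the choice does not matter. The monad laws are those
  of term substitution.\<close>

text \<open>As simp rules these have an extra variable in their premise and make \<open>nlists_def\<close> loop.\<close>

declare nlistsE_length [simp del] nlistsE_set [simp del]

section \<open>Terms and substitution\<close>

text \<open>Associativity of substitution. Naturality and associativity of flattening both come down
  to it.\<close>

lemma subst_subst: "subst \<sigma> (subst \<tau> t) = subst (subst \<sigma> \<circ> \<tau>) t"
  by (induction t) auto

text \<open>Renaming leaves is a special substitution, so the laws mixing \<open>map_tm\<close> and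
  \<open>subst\<close> are instances of \<open>subst_subst\<close>.\<close>

lemma map_tm_eq_subst: "map_tm id f t = subst (Var \<circ> f) t"
  by (induction t) auto

lemma subst_map_tm: "subst \<sigma> (map_tm id f t) = subst (\<sigma> \<circ> f) t"
  by (simp add: map_tm_eq_subst subst_subst comp_def)

lemma map_tm_subst: "map_tm id f (subst \<sigma> t) = subst (map_tm id f \<circ> \<sigma>) t"
  by (simp add: map_tm_eq_subst subst_subst comp_def)

lemma subst_Var: "subst Var t = t"
  by (induction t) (auto simp: map_idI)

lemma map_tm_cong_terms:
  assumes "t \<in> terms \<Sigma> V" "\<And>v. v \<in> V \<Longrightarrow> f v = g v"
  shows "map_tm id f t = map_tm id g t"
  using assms by induction auto

lemma subst_in_terms:
  assumes "t \<in> terms \<Sigma> V" "\<sigma> \<in> V \<rightarrow> terms \<Sigma> W"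
  shows "subst \<sigma> t \<in> terms \<Sigma> W"
  using assms by induction (auto intro!: terms.Fn)

lemma map_tm_in_terms:
  assumes "t \<in> terms \<Sigma> V" "f \<in> V \<rightarrow> W"
  shows "map_tm id f t \<in> terms \<Sigma> W"
  unfolding map_tm_eq_subst
  by (rule subst_in_terms[OF assms(1)]) (use assms(2) in \<open>auto intro!: terms.Var\<close>)

text \<open>Any term over an image lifts along \<open>g\<close> by choosing a preimage of each leaf.
  With \<open>g\<close> the class map, this gives terms over classes leaves that are
  representatives.\<close>

lemma terms_image: "terms \<Sigma> (g ` V) = map_tm id g ` terms \<Sigma> V"
proof
  show "terms \<Sigma> (g ` V) \<subseteq> map_tm id g ` terms \<Sigma> V"
  proof
    fix t assume "t \<in> terms \<Sigma> (g ` V)"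
    then have "map_tm id (inv_into V g) t \<in> terms \<Sigma> V"
      by (rule map_tm_in_terms) (auto simp: inv_into_into)
    moreover have "map_tm id g (map_tm id (inv_into V g) t) = map_tm id id t"
      using \<open>t \<in> terms \<Sigma> (g ` V)\<close>
      by (simp add: tm.map_comp) (auto intro!: map_tm_cong_terms simp: f_inv_into_f)
    ultimately show "t \<in> map_tm id g ` terms \<Sigma> V" by (metis image_eqI tm.map_id)
  qed
  show "map_tm id g ` terms \<Sigma> V \<subseteq> terms \<Sigma> (g ` V)"
    by (auto intro!: map_tm_in_terms)
qed

lemma flatten_in_terms: "u \<in> terms \<Sigma> (terms \<Sigma> V) \<Longrightarrow> subst id u \<in> terms \<Sigma> V"
  by (rule subst_in_terms) auto

lemma terms_Fn_iff:
  "Fn p ts \<in> terms \<Sigma> V \<longleftrightarrow>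
     p \<in> symbols \<Sigma> \<and> length ts = arity \<Sigma> p \<and> set ts \<subseteq> terms \<Sigma> V"
  by (auto elim: terms.cases intro: terms.Fn)

lemma terms_Var_iff: "Var v \<in> terms \<Sigma> V \<longleftrightarrow> v \<in> V"
  by (auto elim: terms.cases intro: terms.Var)

lemma equations_iff:
  "Eq s t \<in> equations \<Sigma> X \<longleftrightarrow> s \<in> terms \<Sigma> X \<and> t \<in> terms \<Sigma> X"
  "QEq \<epsilon> s t \<in> equations \<Sigma> X \<longleftrightarrow> \<epsilon> \<in> {0..1} \<and> s \<in> terms \<Sigma> X \<and> t \<in> terms \<Sigma> X"
  by (auto simp: equations_def)

lemma horn_clauses_iff: "(\<Gamma>, \<phi>) \<in> horn_clauses \<Sigma> X \<longleftrightarrow> \<Gamma> \<subseteq> equations \<Sigma> X \<and> \<phi> \<in> equations \<Sigma> X"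
  by (simp add: horn_clauses_def)

lemma map_eqn_in_equations:
  assumes "\<phi> \<in> equations \<Sigma> X" "\<And>t. t \<in> terms \<Sigma> X \<Longrightarrow> h t \<in> terms \<Sigma>' X'"
  shows "map_eqn h \<phi> \<in> equations \<Sigma>' X'"
  using assms by (cases \<phi>) (auto simp: equations_iff)

lemma map_horn_in_horn_clauses:
  assumes "c \<in> horn_clauses \<Sigma> X" "\<And>t. t \<in> terms \<Sigma> X \<Longrightarrow> h t \<in> terms \<Sigma>' X'"
  shows "map_horn h c \<in> horn_clauses \<Sigma>' X'"
proof -
  have "map_eqn h \<phi> \<in> equations \<Sigma>' X'" if "\<phi> \<in> equations \<Sigma> X" for \<phi>
    using map_eqn_in_equations[OF that] assms(2) by blast
  then show ?thesis using assms(1) unfolding horn_clauses_def map_horn_def by (auto simp: subset_iff)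
qed

lemma map_horn_comp: "map_horn g (map_horn h c) = map_horn (g \<circ> h) c"
  by (cases c) (auto simp: map_horn_def image_image eqn.map_comp)

section \<open>Derived rules of quantitative theories\<close>

lemma quantitative_theoryI:
  assumes "\<And>c. c \<in> Th \<Longrightarrow> c \<in> horn_clauses \<Sigma> X"
    and "\<And>c. c \<in> basic_clauses G \<Sigma> X \<Longrightarrow> c \<in> Th"
    and "\<And>c \<sigma>. c \<in> Th \<Longrightarrow> \<sigma> \<in> X \<rightarrow> terms \<Sigma> X \<Longrightarrow> map_horn (subst \<sigma>) c \<in> Th"
    and "\<And>\<Gamma> \<Gamma>' \<psi>. \<Gamma> \<subseteq> equations \<Sigma> X \<Longrightarrow> (\<And>\<phi>. \<phi> \<in> \<Gamma>' \<Longrightarrow> (\<Gamma>, \<phi>) \<in> Th) \<Longrightarrow> (\<Gamma>', \<psi>) \<in> Th \<Longrightarrow>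
      (\<Gamma>, \<psi>) \<in> Th"
    and "\<And>\<Gamma> \<phi>. \<Gamma> \<subseteq> equations \<Sigma> X \<Longrightarrow> \<phi> \<in> \<Gamma> \<Longrightarrow> (\<Gamma>, \<phi>) \<in> Th"
  shows "quantitative_theory G \<Sigma> X Th"
  unfolding quantitative_theory_def
proof (intro conjI allI impI subsetI; (elim conjE)?)
  fix \<Gamma> \<Gamma>' \<psi>
  assume "\<Gamma> \<subseteq> equations \<Sigma> X" "\<forall>\<phi>\<in>\<Gamma>'. (\<Gamma>, \<phi>) \<in> Th" "(\<Gamma>', \<psi>) \<in> Th"
  then show "(\<Gamma>, \<psi>) \<in> Th" using assms(4)[of \<Gamma> \<Gamma>'] by simp
qed (fact assms)+

lemma quantitative_theory_horn_clauses:
  "quantitative_theory G \<Sigma> X Th \<Longrightarrow> c \<in> Th \<Longrightarrow> c \<in> horn_clauses \<Sigma> X"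
  unfolding quantitative_theory_def by (elim conjE) (rule subsetD)

lemma quantitative_theory_basic:
  "quantitative_theory G \<Sigma> X Th \<Longrightarrow> c \<in> basic_clauses G \<Sigma> X \<Longrightarrow> c \<in> Th"
  unfolding quantitative_theory_def by (elim conjE) (rule subsetD)

lemma quantitative_theory_subst:
  assumes "quantitative_theory G \<Sigma> X Th" "c \<in> Th" "\<sigma> \<in> X \<rightarrow> terms \<Sigma> X"
  shows "map_horn (subst \<sigma>) c \<in> Th"
  by (rule assms(1)[unfolded quantitative_theory_def, THEN conjunct2, THEN conjunct2,
    THEN conjunct1, rule_format, OF conjI[OF assms(2,3)]])

lemma quantitative_theory_cut:
  assumes "quantitative_theory G \<Sigma> X Th" "\<Gamma> \<subseteq> equations \<Sigma> X" "\<And>\<phi>. \<phi> \<in> \<Gamma>' \<Longrightarrow> (\<Gamma>, \<phi>) \<in> Th"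
    "(\<Gamma>', \<psi>) \<in> Th"
  shows "(\<Gamma>, \<psi>) \<in> Th"
  by (rule assms(1)[unfolded quantitative_theory_def, THEN conjunct2, THEN conjunct2,
    THEN conjunct2, THEN conjunct1, rule_format, of \<Gamma> \<Gamma>']) (use assms(2-4) in simp)

lemma quantitative_theory_hyp:
  assumes "quantitative_theory G \<Sigma> X Th" "\<Gamma> \<subseteq> equations \<Sigma> X" "\<phi> \<in> \<Gamma>"
  shows "(\<Gamma>, \<phi>) \<in> Th"
  by (rule assms(1)[unfolded quantitative_theory_def, THEN conjunct2, THEN conjunct2,
    THEN conjunct2, THEN conjunct2, rule_format, OF conjI[OF assms(2,3)]])

section \<open>Intersections of theories and the least theory\<close>

lemma quantitative_theory_Inter:
  assumes "\<T> \<noteq> {}" and th: "\<And>Th. Th \<in> \<T> \<Longrightarrow> quantitative_theory G \<Sigma> X Th"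
  shows "quantitative_theory G \<Sigma> X (\<Inter>\<T>)"
proof (rule quantitative_theoryI)
  show "c \<in> horn_clauses \<Sigma> X" if "c \<in> \<Inter>\<T>" for c
    using assms(1) that quantitative_theory_horn_clauses[OF th] by blast
  show "c \<in> \<Inter>\<T>" if "c \<in> basic_clauses G \<Sigma> X" for c
    using that quantitative_theory_basic[OF th] by blast
  show "map_horn (subst \<sigma>) c \<in> \<Inter>\<T>" if "c \<in> \<Inter>\<T>" "\<sigma> \<in> X \<rightarrow> terms \<Sigma> X" for c \<sigma>
    using that quantitative_theory_subst[OF th] by blast
  show "(\<Gamma>, \<psi>) \<in> \<Inter>\<T>"
    if \<Gamma>: "\<Gamma> \<subseteq> equations \<Sigma> X" "\<And>\<phi>. \<phi> \<in> \<Gamma>' \<Longrightarrow> (\<Gamma>, \<phi>) \<in> \<Inter>\<T>" and \<psi>: "(\<Gamma>', \<psi>) \<in> \<Inter>\<T>" for \<Gamma> \<Gamma>' \<psi>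
  proof (rule InterI)
    fix Th assume Th: "Th \<in> \<T>"
    show "(\<Gamma>, \<psi>) \<in> Th"
      using quantitative_theory_cut[OF th[OF Th] \<Gamma>(1), of \<Gamma>' \<psi>] Th \<Gamma>(2) \<psi> by blast
  qed
  show "(\<Gamma>, \<phi>) \<in> \<Inter>\<T>" if "\<Gamma> \<subseteq> equations \<Sigma> X" "\<phi> \<in> \<Gamma>" for \<Gamma> \<phi>
    using that quantitative_theory_hyp[OF th] by blast
qed

lemma Inf_insert_1_in_unit: "E \<subseteq> {0..1} \<Longrightarrow> Inf (insert 1 E) \<in> {0..1::real}"
  by (auto intro!: cInf_greatest cInf_lower bdd_belowI[of _ 0])

text \<open>The delicate point is the index in \<open>L_NE\<close>, which must lie in the unit
  interval. Only this bound on the lifted distances is assumed, so that the lemma also applies to a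
  signature extended by constants.\<close>

lemma basic_clauses_subset_horn_clauses:
  assumes lift_unit: "\<And>p M xs ys. p \<in> symbols \<Sigma> \<Longrightarrow> M \<in> GMet G \<Longrightarrow>
    xs \<in> nlists (arity \<Sigma> p) (fst M) \<Longrightarrow> ys \<in> nlists (arity \<Sigma> p) (fst M) \<Longrightarrow>
    lift \<Sigma> p M xs ys \<in> {0..1}"
  shows "basic_clauses G \<Sigma> X \<subseteq> horn_clauses \<Sigma> X"
proof (rule subrelI)
  have L_NE_clause: "({QEq (\<Delta> w z) (Var w) (Var z) | w z. w \<in> V \<and> z \<in> V},
      QEq (lift \<Sigma> p (V, \<Delta>) xs ys) (Fn p (map Var xs)) (Fn p (map Var ys))) \<in> horn_clauses \<Sigma> X"
    if p: "p \<in> symbols \<Sigma>" and xs: "xs \<in> nlists (arity \<Sigma> p) X" and ys: "ys \<in> nlists (arity \<Sigma> p) X"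
      and V: "V = set xs \<union> set ys" and \<Delta>: "(V, \<Delta>) \<in> GMet G" for p xs ys V \<Delta>
  proof -
    have *: "set xs \<subseteq> X" "set ys \<subseteq> X" "length xs = arity \<Sigma> p" "length ys = arity \<Sigma> p"
      using xs ys by (simp_all add: nlists_def)
    have "lift \<Sigma> p (V, \<Delta>) xs ys \<in> {0..1}"
      by (rule lift_unit[OF p \<Delta>]) (use V * in \<open>simp_all add: nlists_def\<close>)
    moreover have "\<Delta> w z \<in> {0..1}" if "w \<in> V" "z \<in> V" for w z
      using \<Delta> that by (simp add: GMet_def)
    moreover have "V \<subseteq> X" using V * by simp
    ultimately show ?thesis using p *
      by (auto simp: horn_clauses_iff equations_iff terms_Var_iff terms_Fn_iff subset_iff)
  qed
  fix \<Gamma> \<phi> assume "(\<Gamma>, \<phi>) \<in> basic_clauses G \<Sigma> X"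
  then show "(\<Gamma>, \<phi>) \<in> horn_clauses \<Sigma> X"
  proof induction
    case (Infi x y E)
    then show ?case using Inf_insert_1_in_unit[of E]
      by (auto simp: horn_clauses_iff equations_iff terms_Var_iff)
  next
    case (Eq_cong p xs ys)
    then show ?case
      by (auto simp: horn_clauses_iff equations_iff terms_Var_iff terms_Fn_iff nlists_def subset_iff)
  next
    case (L_NE p xs ys V \<Delta>)
    then show ?case by (rule L_NE_clause)
  qed (auto simp: horn_clauses_iff equations_iff terms_Var_iff)
qed

text \<open>Makes the family intersected in \<open>least_theory\<close> nonempty: the set of all
  Horn clauses is a theory containing every admissible \<open>S\<close>.\<close>

lemma quantitative_theory_all_clauses:
  assumes "basic_clauses G \<Sigma> X \<subseteq> horn_clauses \<Sigma> X"
  shows "quantitative_theory G \<Sigma> X (horn_clauses \<Sigma> X)"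
proof (rule quantitative_theoryI)
  show "map_horn (subst \<sigma>) c \<in> horn_clauses \<Sigma> X"
    if "c \<in> horn_clauses \<Sigma> X" "\<sigma> \<in> X \<rightarrow> terms \<Sigma> X" for c \<sigma>
    using map_horn_in_horn_clauses[OF that(1)] subst_in_terms[OF _ that(2)] by blast
qed (use assms in \<open>auto simp: horn_clauses_iff\<close>)

lemma quantitative_theory_least_theory:
  assumes "basic_clauses G \<Sigma> X \<subseteq> horn_clauses \<Sigma> X" "S \<subseteq> horn_clauses \<Sigma> X"
  shows "quantitative_theory G \<Sigma> X (least_theory G \<Sigma> X S)"
  unfolding least_theory_def
  by (rule quantitative_theory_Inter)
    (use quantitative_theory_all_clauses[OF assms(1)] assms(2) in blast)+

lemma least_theory_superset: "S \<subseteq> least_theory G \<Sigma> X S"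
  unfolding least_theory_def by blast

lemma least_theory_least:
  "quantitative_theory G \<Sigma> X Th \<Longrightarrow> S \<subseteq> Th \<Longrightarrow> least_theory G \<Sigma> X S \<subseteq> Th"
  unfolding least_theory_def by blast

section \<open>The basic clauses as derivation rules on arbitrary terms\<close>

locale quantitative_theory_rules =
  fixes G :: "gmet_axiom set" and \<Sigma> :: "('op, 'u) lsig" and X :: "'u set"
    and Th :: "('op, 'u) tm horn set"
  assumes is_theory: "quantitative_theory G \<Sigma> X Th" and infinite_vars: "infinite X"
begin

lemmas in_horn_clauses = quantitative_theory_horn_clauses[OF is_theory]
  and basic = quantitative_theory_basic[OF is_theory]
  and substitution = quantitative_theory_subst[OF is_theory]
  and cut = quantitative_theory_cut[OF is_theory]

lemma in_equations: "({}, \<phi>) \<in> Th \<Longrightarrow> \<phi> \<in> equations \<Sigma> X"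
  by (drule in_horn_clauses) (simp add: horn_clauses_iff)

text \<open>Sub followed by Cut with the empty context: if all instantiated premises are provable
  without hypotheses, so is the instantiated conclusion.\<close>

lemma apply_instance:
  assumes "(\<Gamma>, \<phi>) \<in> basic_clauses G \<Sigma> X" "\<sigma> \<in> X \<rightarrow> terms \<Sigma> X"
    and "\<forall>\<psi>\<in>\<Gamma>. ({}, map_eqn (subst \<sigma>) \<psi>) \<in> Th"
  shows "({}, map_eqn (subst \<sigma>) \<phi>) \<in> Th"
proof (rule cut)
  show "(map_eqn (subst \<sigma>) ` \<Gamma>, map_eqn (subst \<sigma>) \<phi>) \<in> Th"
    using substitution[OF basic[OF assms(1)] assms(2)] by (simp add: map_horn_def)
qed (use assms(3) in auto)

text \<open>Distinct variables can be sent to arbitrary terms independently. Three of them suffice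
  for all basic clauses except \<open>Eq_cong\<close> and \<open>L_NE\<close>; clauses with fewer
  variables repeat a term as padding.\<close>

lemma three_variables:
  assumes "s \<in> terms \<Sigma> X" "t \<in> terms \<Sigma> X" "r \<in> terms \<Sigma> X"
  obtains x y z \<sigma> where "x \<in> X" "y \<in> X" "z \<in> X" "\<sigma> \<in> X \<rightarrow> terms \<Sigma> X"
    "\<sigma> x = s" "\<sigma> y = t" "\<sigma> z = r"
proof -
  obtain V where V: "V \<subseteq> X" "card V = 3"
    using infinite_arbitrarily_large[OF infinite_vars] by blast
  then obtain x y z where xyz: "V = {x, y, z}" "x \<noteq> y" "x \<noteq> z" "y \<noteq> z"
    by (metis card_3_iff)
  show thesis
    by (rule that[of x y z "\<lambda>v. if v = x then s else if v = y then t else r"])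
      (use V xyz assms in auto)
qed

lemma Eq_refl_rule:
  assumes "s \<in> terms \<Sigma> X"
  shows "({}, Eq s s) \<in> Th"
proof -
  obtain x y z \<sigma> where inst: "x \<in> X" "y \<in> X" "z \<in> X" "\<sigma> \<in> X \<rightarrow> terms \<Sigma> X"
    "\<sigma> x = s" "\<sigma> y = s" "\<sigma> z = s"
    by (rule three_variables[OF assms assms assms])
  show ?thesis
    using apply_instance[OF basic_clauses.Eq_refl[OF inst(1)] inst(4)] inst(5) by auto
qed

lemma Top_rule:
  assumes "s \<in> terms \<Sigma> X" "t \<in> terms \<Sigma> X"
  shows "({}, QEq 1 s t) \<in> Th"
proof -
  obtain x y z \<sigma> where inst: "x \<in> X" "y \<in> X" "z \<in> X" "\<sigma> \<in> X \<rightarrow> terms \<Sigma> X"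
    "\<sigma> x = s" "\<sigma> y = t" "\<sigma> z = s"
    by (rule three_variables[OF assms assms(1)])
  show ?thesis
    using apply_instance[OF basic_clauses.Top[OF inst(1,2)] inst(4)] inst(5,6) by auto
qed

lemma Refl_rule:
  assumes "AxR \<in> G" "s \<in> terms \<Sigma> X"
  shows "({}, QEq 0 s s) \<in> Th"
proof -
  obtain x y z \<sigma> where inst: "x \<in> X" "y \<in> X" "z \<in> X" "\<sigma> \<in> X \<rightarrow> terms \<Sigma> X"
    "\<sigma> x = s" "\<sigma> y = s" "\<sigma> z = s"
    by (rule three_variables[OF assms(2) assms(2) assms(2)])
  show ?thesis
    using apply_instance[OF basic_clauses.Refl[OF assms(1) inst(1)] inst(4)] inst(5) by auto
qed

lemma Eq_in_terms:
  assumes "({}, Eq s t) \<in> Th"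
  shows "s \<in> terms \<Sigma> X" "t \<in> terms \<Sigma> X"
  using in_equations[OF assms] by (simp_all add: equations_iff)

lemma QEq_in_terms:
  assumes "({}, QEq \<epsilon> s t) \<in> Th"
  shows "s \<in> terms \<Sigma> X" "t \<in> terms \<Sigma> X"
  using in_equations[OF assms] by (simp_all add: equations_iff)

lemma QEq_index: "({}, QEq \<epsilon> s t) \<in> Th \<Longrightarrow> \<epsilon> \<in> {0..1}"
  using in_equations[of "QEq \<epsilon> s t"] by (simp add: equations_iff)

lemma Eq_sym_rule:
  assumes "({}, Eq s t) \<in> Th"
  shows "({}, Eq t s) \<in> Th"
proof -
  obtain x y z \<sigma> where inst: "x \<in> X" "y \<in> X" "z \<in> X" "\<sigma> \<in> X \<rightarrow> terms \<Sigma> X"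
    "\<sigma> x = s" "\<sigma> y = t" "\<sigma> z = s"
    by (rule three_variables[OF Eq_in_terms(1)[OF assms(1)] Eq_in_terms(2)[OF assms(1)]
      Eq_in_terms(1)[OF assms(1)]])
  show ?thesis
    using apply_instance[OF basic_clauses.Eq_sym[OF inst(1,2)] inst(4)] inst(5,6) assms by auto
qed

lemma Eq_trans_rule:
  assumes "({}, Eq s t) \<in> Th" "({}, Eq t r) \<in> Th"
  shows "({}, Eq s r) \<in> Th"
proof -
  obtain x y z \<sigma> where inst: "x \<in> X" "y \<in> X" "z \<in> X" "\<sigma> \<in> X \<rightarrow> terms \<Sigma> X"
    "\<sigma> x = s" "\<sigma> y = t" "\<sigma> z = r"
    by (rule three_variables[OF Eq_in_terms(1)[OF assms(1)] Eq_in_terms(2)[OF assms(1)]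
      Eq_in_terms(2)[OF assms(2)]])
  show ?thesis
    using apply_instance[OF basic_clauses.Eq_trans[OF inst(1-3)] inst(4)] inst(5-7) assms by auto
qed

lemma Up_rule:
  assumes "({}, QEq \<epsilon> s t) \<in> Th" "\<epsilon> \<le> \<epsilon>'" "\<epsilon>' \<le> 1"
  shows "({}, QEq \<epsilon>' s t) \<in> Th"
proof -
  obtain x y z \<sigma> where inst: "x \<in> X" "y \<in> X" "z \<in> X" "\<sigma> \<in> X \<rightarrow> terms \<Sigma> X"
    "\<sigma> x = s" "\<sigma> y = t" "\<sigma> z = s"
    by (rule three_variables[OF QEq_in_terms(1)[OF assms(1)] QEq_in_terms(2)[OF assms(1)]
      QEq_in_terms(1)[OF assms(1)]])
  have \<epsilon>': "\<epsilon>' \<in> {0..1}" using QEq_index[OF assms(1)] assms(2,3) by auto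
  show ?thesis
    using apply_instance[OF basic_clauses.Up[OF inst(1,2) QEq_index[OF assms(1)] \<epsilon>' assms(2)] inst(4)]
      inst(5,6) assms(1) by auto
qed

lemma Infi_rule:
  assumes "s \<in> terms \<Sigma> X" "t \<in> terms \<Sigma> X" "\<And>\<epsilon>. \<epsilon> \<in> E \<Longrightarrow> ({}, QEq \<epsilon> s t) \<in> Th"
  shows "({}, QEq (Inf (insert 1 E)) s t) \<in> Th"
proof -
  obtain x y z \<sigma> where inst: "x \<in> X" "y \<in> X" "z \<in> X" "\<sigma> \<in> X \<rightarrow> terms \<Sigma> X"
    "\<sigma> x = s" "\<sigma> y = t" "\<sigma> z = s"
    by (rule three_variables[OF assms(1,2,1)])
  have E: "E \<subseteq> {0..1}" using assms(3) QEq_index by blast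
  have "\<forall>\<psi>\<in>{QEq \<epsilon> (Var x) (Var y) | \<epsilon>. \<epsilon> \<in> E}. ({}, map_eqn (subst \<sigma>) \<psi>) \<in> Th"
    using inst(5,6) assms(3) by auto
  from apply_instance[OF basic_clauses.Infi[OF inst(1,2) E] inst(4) this] show ?thesis
    using inst(5,6) by simp
qed

lemma Eq_left_rule:
  assumes "({}, Eq s t) \<in> Th" "({}, QEq \<epsilon> s r) \<in> Th"
  shows "({}, QEq \<epsilon> t r) \<in> Th"
proof -
  obtain x y z \<sigma> where inst: "x \<in> X" "y \<in> X" "z \<in> X" "\<sigma> \<in> X \<rightarrow> terms \<Sigma> X"
    "\<sigma> x = s" "\<sigma> y = t" "\<sigma> z = r"
    by (rule three_variables[OF Eq_in_terms(1)[OF assms(1)] Eq_in_terms(2)[OF assms(1)]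
      QEq_in_terms(2)[OF assms(2)]])
  show ?thesis
    using apply_instance[OF basic_clauses.Eq_left[OF inst(1-3) QEq_index[OF assms(2)]] inst(4)]
      inst(5-7) assms by auto
qed

lemma Eq_right_rule:
  assumes "({}, Eq s t) \<in> Th" "({}, QEq \<epsilon> r s) \<in> Th"
  shows "({}, QEq \<epsilon> r t) \<in> Th"
proof -
  obtain x y z \<sigma> where inst: "x \<in> X" "y \<in> X" "z \<in> X" "\<sigma> \<in> X \<rightarrow> terms \<Sigma> X"
    "\<sigma> x = s" "\<sigma> y = t" "\<sigma> z = r"
    by (rule three_variables[OF Eq_in_terms(1)[OF assms(1)] Eq_in_terms(2)[OF assms(1)]
      QEq_in_terms(1)[OF assms(2)]])
  show ?thesis
    using apply_instance[OF basic_clauses.Eq_right[OF inst(1-3) QEq_index[OF assms(2)]] inst(4)]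
      inst(5-7) assms by auto
qed

lemma Sym_rule:
  assumes "AxS \<in> G" "({}, QEq \<epsilon> s t) \<in> Th"
  shows "({}, QEq \<epsilon> t s) \<in> Th"
proof -
  obtain x y z \<sigma> where inst: "x \<in> X" "y \<in> X" "z \<in> X" "\<sigma> \<in> X \<rightarrow> terms \<Sigma> X"
    "\<sigma> x = s" "\<sigma> y = t" "\<sigma> z = s"
    by (rule three_variables[OF QEq_in_terms(1)[OF assms(2)] QEq_in_terms(2)[OF assms(2)]
      QEq_in_terms(1)[OF assms(2)]])
  show ?thesis
    using apply_instance[OF basic_clauses.Sym[OF assms(1) inst(1,2) QEq_index[OF assms(2)]] inst(4)]
      inst(5,6) assms(2) by auto
qed

lemma Ident_rule:
  assumes "AxI \<in> G" "({}, QEq 0 s t) \<in> Th"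
  shows "({}, Eq s t) \<in> Th"
proof -
  obtain x y z \<sigma> where inst: "x \<in> X" "y \<in> X" "z \<in> X" "\<sigma> \<in> X \<rightarrow> terms \<Sigma> X"
    "\<sigma> x = s" "\<sigma> y = t" "\<sigma> z = s"
    by (rule three_variables[OF QEq_in_terms(1)[OF assms(2)] QEq_in_terms(2)[OF assms(2)]
      QEq_in_terms(1)[OF assms(2)]])
  show ?thesis
    using apply_instance[OF basic_clauses.Ident[OF assms(1) inst(1,2)] inst(4)]
      inst(5,6) assms(2) by auto
qed

lemma Tri_rule:
  assumes "AxT \<in> G" "({}, QEq \<epsilon> s t) \<in> Th" "({}, QEq \<epsilon>' t r) \<in> Th" "\<epsilon> + \<epsilon>' \<le> 1"
  shows "({}, QEq (\<epsilon> + \<epsilon>') s r) \<in> Th"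
proof -
  obtain x y z \<sigma> where inst: "x \<in> X" "y \<in> X" "z \<in> X" "\<sigma> \<in> X \<rightarrow> terms \<Sigma> X"
    "\<sigma> x = s" "\<sigma> y = t" "\<sigma> z = r"
    by (rule three_variables[OF QEq_in_terms(1)[OF assms(2)] QEq_in_terms(2)[OF assms(2)]
      QEq_in_terms(2)[OF assms(3)]])
  show ?thesis
    using apply_instance[OF basic_clauses.Tri[OF assms(1) inst(1-3) assms(2,3)[THEN QEq_index] assms(4)] inst(4)]
      inst(5-7) assms(2,3) by auto
qed

lemma Ultra_rule:
  assumes "AxU \<in> G" "({}, QEq \<epsilon> s t) \<in> Th" "({}, QEq \<epsilon>' t r) \<in> Th"
  shows "({}, QEq (max \<epsilon> \<epsilon>') s r) \<in> Th"
proof -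
  obtain x y z \<sigma> where inst: "x \<in> X" "y \<in> X" "z \<in> X" "\<sigma> \<in> X \<rightarrow> terms \<Sigma> X"
    "\<sigma> x = s" "\<sigma> y = t" "\<sigma> z = r"
    by (rule three_variables[OF QEq_in_terms(1)[OF assms(2)] QEq_in_terms(2)[OF assms(2)]
      QEq_in_terms(2)[OF assms(3)]])
  show ?thesis
    using apply_instance[OF basic_clauses.Ultra[OF assms(1) inst(1-3) assms(2,3)[THEN QEq_index]] inst(4)]
      inst(5-7) assms(2,3) by auto
qed

lemma Eq_cong_rule:
  assumes p: "p \<in> symbols \<Sigma>" and len: "length ss = arity \<Sigma> p" "length ts = arity \<Sigma> p"
    and eq: "\<And>i. i < arity \<Sigma> p \<Longrightarrow> ({}, Eq (ss ! i) (ts ! i)) \<in> Th"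
  shows "({}, Eq (Fn p ss) (Fn p ts)) \<in> Th"
proof -
  let ?n = "arity \<Sigma> p"
  obtain V where V: "V \<subseteq> X" "card V = ?n + ?n" "finite V"
    using infinite_arbitrarily_large[OF infinite_vars] by blast
  obtain zs where zs: "set zs = V" "distinct zs" using finite_distinct_list[OF V(3)] by blast
  have len_zs: "length zs = ?n + ?n" using zs V(2) distinct_card by fastforce
  \<comment> \<open>The \<open>?n + ?n\<close> distinct variables \<open>zs\<close> are sent to the
    arguments \<open>ss @ ts\<close>, so that the two halves of \<open>zs\<close> can serve as the
    two argument lists of the clause. All other variables stay fixed, which keeps \<sigma> a
    substitution into terms.\<close>
  define \<sigma> where
    "\<sigma> v = (case map_of (zip zs (ss @ ts)) v of Some t \<Rightarrow> t | None \<Rightarrow> Var v)" for v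
  have \<sigma>_nth: "\<sigma> (zs ! i) = (ss @ ts) ! i" if "i < ?n + ?n" for i
    using map_of_zip_nth[OF _ zs(2), of "ss @ ts" i] that len len_zs by (simp add: \<sigma>_def)
  have args: "set (ss @ ts) \<subseteq> terms \<Sigma> X"
    using Eq_in_terms[OF eq] len by (auto simp: in_set_conv_nth)
  have \<sigma>: "\<sigma> \<in> X \<rightarrow> terms \<Sigma> X"
    using args by (auto simp: \<sigma>_def terms_Var_iff subset_iff
      dest!: map_of_SomeD set_zip_rightD split: option.split)
  define xs ys where "xs = take ?n zs" and "ys = drop ?n zs"
  have xs: "xs \<in> nlists ?n X" and ys: "ys \<in> nlists ?n X"
    using zs V(1) len_zs set_take_subset[of ?n zs] set_drop_subset[of ?n zs]
    by (auto simp: xs_def ys_def nlists_def)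
  have \<sigma>_args: "map \<sigma> xs = ss" "map \<sigma> ys = ts"
    using len len_zs \<sigma>_nth by (auto simp: list_eq_iff_nth_eq nth_append xs_def ys_def)
  have \<sigma>_nth': "\<sigma> (xs ! i) = ss ! i" "\<sigma> (ys ! i) = ts ! i" if "i < ?n" for i
    using that \<sigma>_args xs ys by (auto simp: nlists_def nth_map[symmetric] simp del: nth_map)
  have "\<forall>\<psi>\<in>{Eq (Var (xs ! i)) (Var (ys ! i)) | i. i < ?n}. ({}, map_eqn (subst \<sigma>) \<psi>) \<in> Th"
    using \<sigma>_nth' eq by auto
  from apply_instance[OF basic_clauses.Eq_cong[OF p xs ys] \<sigma> this] show ?thesis
    using \<sigma>_args by (simp add: comp_def)
qed

end

section \<open>Interpreting constants by terms\<close>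

lemma add_constants_simps [simp]:
  "symbols (add_constants G \<Sigma> A) = symbols \<Sigma> <+> A"
  "arity (add_constants G \<Sigma> A) (Inl p) = arity \<Sigma> p"
  "arity (add_constants G \<Sigma> A) (Inr a) = 0"
  "lift (add_constants G \<Sigma> A) (Inl p) = lift \<Sigma> p"
  "lift (add_constants G \<Sigma> A) (Inr a) = (\<lambda>_ _ _. if AxR \<in> G then 0 else 1)"
  by (simp_all add: add_constants_def)

text \<open>The translation of terms over one space into terms over another: variables and original
  symbols stay, and constants become ground terms. The arguments of a constant are dropped; in a
  well-formed term there are none.\<close>

primrec interpret_constants ::
  "('a \<Rightarrow> ('op, 'b) tm) \<Rightarrow> ('op + 'a, 'u) tm \<Rightarrow> ('op + 'b, 'u) tm" where
  "interpret_constants k (Var v) = Var v"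
| "interpret_constants k (Fn q ts) =
     (case q of Inl p \<Rightarrow> Fn (Inl p) (map (interpret_constants k) ts) | Inr a \<Rightarrow> ground (k a))"

text \<open>Under the identification of ground terms with \<open>terms \<Sigma> A\<close>, the
  translation is the substitution of \<open>k\<close>.\<close>

lemma interpret_constants_ground: "interpret_constants k (ground t) = ground (subst k t)"
  by (induction t) auto

lemma subst_ground: "subst \<sigma> (ground t) = ground t"
  by (induction t) auto

text \<open>The terms put in for constants are ground, hence by \<open>subst_ground\<close> no later
  substitution changes them.\<close>

lemma interpret_constants_subst:
  "interpret_constants k (subst \<sigma> t) = subst (interpret_constants k \<circ> \<sigma>) (interpret_constants k t)"
  by (induction t) (auto simp: subst_ground split: sum.split)

lemma interpret_constants_map_tm_Inl: "interpret_constants k (map_tm Inl id t) = map_tm Inl id t"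
  by (induction t) auto

lemma ground_in_terms: "t \<in> terms \<Sigma> A \<Longrightarrow> ground t \<in> terms (add_constants G \<Sigma> A) X"
  by (induction rule: terms.induct) (auto simp: terms_Fn_iff)

lemma map_tm_Inl_in_terms:
  "t \<in> terms \<Sigma> X \<Longrightarrow> map_tm Inl id t \<in> terms (add_constants G \<Sigma> A) X"
  by (induction rule: terms.induct) (auto simp: terms_Fn_iff terms_Var_iff)

lemma interpret_constants_in_terms:
  assumes "t \<in> terms (add_constants G \<Sigma> A) X" "k \<in> A \<rightarrow> terms \<Sigma> B"
  shows "interpret_constants k t \<in> terms (add_constants G \<Sigma> B) X"
  using assms
proof (induction rule: terms.induct)
  case (Fn q ts)
  then show ?case by (cases q) (auto simp: terms_Fn_iff intro!: ground_in_terms)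
qed (simp add: terms_Var_iff)

section \<open>The theory of a space\<close>

locale lifted_horn_theory =
  fixes G :: "gmet_axiom set" and \<Sigma> :: "('op, 'u) lsig" and X :: "'u set"
    and S :: "('op, 'u) tm horn set"
  assumes lifted: "lifted_signature G \<Sigma>" and infinite_vars: "infinite X"
    and clauses: "S \<subseteq> horn_clauses \<Sigma> X"
begin

lemma lift_in_unit:
  assumes "p \<in> symbols \<Sigma>" "M \<in> GMet G" "xs \<in> nlists (arity \<Sigma> p) (fst M)"
    "ys \<in> nlists (arity \<Sigma> p) (fst M)"
  shows "lift \<Sigma> p M xs ys \<in> {0..1}"
proof -
  have "power_space (arity \<Sigma> p) (lift \<Sigma> p) M \<in> GMet G"
    using lifted assms(1,2) unfolding lifted_signature_def is_lifting_def by blast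
  then show ?thesis using assms(3,4) unfolding power_space_def GMet_def by simp
qed

text \<open>It suffices that the basic and the generating clauses are Horn clauses over the extended
  signature. The lifted distances of old symbols lie in the unit interval by
  \<open>lift_in_unit\<close>, and those of constants are 0 or 1.\<close>

lemma theory_of_is_theory:
  assumes "M \<in> GMet G"
  shows "quantitative_theory G (add_constants G \<Sigma> (fst M)) X (theory_of G \<Sigma> X S M)"
  unfolding theory_of_def
proof (rule quantitative_theory_least_theory[OF basic_clauses_subset_horn_clauses])
  fix q xs ys and N :: "'u fuzzy"
  assume "q \<in> symbols (add_constants G \<Sigma> (fst M))" "N \<in> GMet G"
    "xs \<in> nlists (arity (add_constants G \<Sigma> (fst M)) q) (fst N)"
    "ys \<in> nlists (arity (add_constants G \<Sigma> (fst M)) q) (fst N)"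
  then show "lift (add_constants G \<Sigma> (fst M)) q N xs ys \<in> {0..1}"
    using lift_in_unit[of _ N xs ys] by (cases q) auto
next
  have "map_horn (map_tm Inl id) c \<in> horn_clauses (add_constants G \<Sigma> (fst M)) X" if "c \<in> S" for c
    using that clauses map_tm_Inl_in_terms by (blast intro: map_horn_in_horn_clauses)
  moreover have "({}, QEq (snd M a a') (Fn (Inr a) []) (Fn (Inr a') []))
      \<in> horn_clauses (add_constants G \<Sigma> (fst M)) X" if "a \<in> fst M" "a' \<in> fst M" for a a'
    using assms that by (auto simp: GMet_def horn_clauses_iff equations_iff terms_Fn_iff)
  ultimately show "map_horn (map_tm Inl id) ` S \<union>
      {({}, QEq (snd M a a') (Fn (Inr a) []) (Fn (Inr a') [])) | a a'. a \<in> fst M \<and> a' \<in> fst M}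
      \<subseteq> horn_clauses (add_constants G \<Sigma> (fst M)) X"
    by blast
qed

lemma theory_of_rules:
  "M \<in> GMet G \<Longrightarrow>
     quantitative_theory_rules G (add_constants G \<Sigma> (fst M)) X (theory_of G \<Sigma> X S M)"
  by (simp add: quantitative_theory_rules_def theory_of_is_theory infinite_vars)

lemma theory_of_clause: "c \<in> S \<Longrightarrow> map_horn (map_tm Inl id) c \<in> theory_of G \<Sigma> X S M"
  unfolding theory_of_def by (rule subsetD[OF least_theory_superset]) blast

lemma theory_of_dist:
  "a \<in> fst M \<Longrightarrow> a' \<in> fst M \<Longrightarrow>
     ({}, QEq (snd M a a') (ground (Var a)) (ground (Var a'))) \<in> theory_of G \<Sigma> X S M"
  unfolding theory_of_def by (rule subsetD[OF least_theory_superset]) auto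

text \<open>For spaces in \<open>GMet G\<close> this says that sending \<open>a\<close> to the class
  of \<open>k a\<close> is a nonexpansive map from \<open>M\<close> to the term space of
  \<open>N\<close>, but phrased by provability on chosen representatives.\<close>

definition interpretation_of :: "'a fuzzy \<Rightarrow> 'b fuzzy \<Rightarrow> ('a \<Rightarrow> ('op, 'b) tm) \<Rightarrow> bool" where
  "interpretation_of M N k \<longleftrightarrow> k \<in> fst M \<rightarrow> terms \<Sigma> (fst N) \<and>
     (\<forall>a\<in>fst M. \<forall>a'\<in>fst M.
        ({}, QEq (snd M a a') (ground (k a)) (ground (k a'))) \<in> theory_of G \<Sigma> X S N)"

text \<open>The clauses whose interpretation holds in \<open>N\<close> form a quantitative theory. Interpreting fixes
  variables, so it fixes all basic clauses except those for the added constants.\<close>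

lemma interpret_constants_theory:
  assumes M: "M \<in> GMet G" and N: "N \<in> GMet G" and k: "interpretation_of M N k"
    and c: "c \<in> theory_of G \<Sigma> X S M"
  shows "map_horn (interpret_constants k) c \<in> theory_of G \<Sigma> X S N"
proof -
  let ?\<Sigma>M = "add_constants G \<Sigma> (fst M)" and ?\<Sigma>N = "add_constants G \<Sigma> (fst N)"
  let ?I = "interpret_constants k"
  interpret M: quantitative_theory_rules G ?\<Sigma>M X "theory_of G \<Sigma> X S M"
    by (rule theory_of_rules[OF M])
  interpret N: quantitative_theory_rules G ?\<Sigma>N X "theory_of G \<Sigma> X S N"
    by (rule theory_of_rules[OF N])
  have k_terms: "k \<in> fst M \<rightarrow> terms \<Sigma> (fst N)" using k by (simp add: interpretation_of_def)
  note I_terms = interpret_constants_in_terms[OF _ k_terms]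
  have I_equations: "map_eqn ?I ` \<Gamma> \<subseteq> equations ?\<Sigma>N X" if "\<Gamma> \<subseteq> equations ?\<Sigma>M X" for \<Gamma>
    using that by (auto intro!: map_eqn_in_equations[of _ ?\<Sigma>M X] I_terms)
  \<comment> \<open>Being a Horn clause over \<open>?\<Sigma>M\<close> is demanded separately: since
    arguments of constants are dropped, an ill-formed clause may have a well-formed
    interpretation.\<close>
  define Th where "Th = {c \<in> horn_clauses ?\<Sigma>M X. map_horn ?I c \<in> theory_of G \<Sigma> X S N}"
  have basic_Th: "map_horn ?I (\<Gamma>, \<phi>) \<in> theory_of G \<Sigma> X S N"
    if "(\<Gamma>, \<phi>) \<in> basic_clauses G ?\<Sigma>M X" for \<Gamma> \<phi>
    using that
  proof induction
    case (Eq_cong q xs ys)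
    show ?case
    proof (cases q)
      case (Inl p)
      have "({Eq (Var (xs ! i)) (Var (ys ! i)) | i. i < arity ?\<Sigma>N (Inl p)},
          Eq (Fn (Inl p) (map Var xs)) (Fn (Inl p) (map Var ys))) \<in> basic_clauses G ?\<Sigma>N X"
        by (rule basic_clauses.Eq_cong) (use Eq_cong Inl in auto)
      then show ?thesis
        using N.basic Inl by (simp add: map_horn_def setcompr_eq_image image_image comp_def)
    next
      \<comment> \<open>A constant has no arguments, so its congruence clause has no premises and
        becomes reflexivity of the ground term \<open>k a\<close>.\<close>
      case (Inr a)
      then have "k a \<in> terms \<Sigma> (fst N)" using Eq_cong k_terms by auto
      then show ?thesis
        using Inr N.Eq_refl_rule[OF ground_in_terms] by (simp add: map_horn_def)
    qed
  next
    case (Infi x y E)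
    then show ?case
      using N.basic[OF basic_clauses.Infi[OF Infi]]
      by (simp add: map_horn_def setcompr_eq_image image_image)
  next
    case (L_NE q xs ys V \<Delta>)
    show ?case
    proof (cases q)
      case (Inl p)
      have "({QEq (\<Delta> w z) (Var w) (Var z) | w z. w \<in> V \<and> z \<in> V},
          QEq (lift ?\<Sigma>N (Inl p) (V, \<Delta>) xs ys) (Fn (Inl p) (map Var xs)) (Fn (Inl p) (map Var ys)))
          \<in> basic_clauses G ?\<Sigma>N X"
        by (rule basic_clauses.L_NE) (use L_NE Inl in auto)
      moreover have "map_eqn ?I ` {QEq (\<Delta> w z) (Var w) (Var z) | w z. w \<in> V \<and> z \<in> V} =
          {QEq (\<Delta> w z) (Var w) (Var z) | w z. w \<in> V \<and> z \<in> V}"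
        by (force simp: image_iff)
      ultimately show ?thesis
        using N.basic Inl by (simp add: map_horn_def comp_def)
    next
      \<comment> \<open>The lifted distance of a constant is 0 or 1. Its clause becomes an instance
        of \<open>Refl\<close> if \<open>AxR \<in> G\<close>, and of \<open>Top\<close>
        otherwise.\<close>
      case (Inr a)
      then have "k a \<in> terms \<Sigma> (fst N)" using L_NE k_terms by auto
      then have "({}, QEq (if AxR \<in> G then 0 else 1) (ground (k a)) (ground (k a)))
          \<in> theory_of G \<Sigma> X S N"
        using N.Refl_rule[OF _ ground_in_terms] N.Top_rule[OF ground_in_terms ground_in_terms]
        by auto
      moreover have "V = {}" using L_NE Inr by auto
      ultimately show ?thesis using Inr by (simp add: map_horn_def)
    qed
  qed (auto simp: map_horn_def simp del: atLeastAtMost_iff intro: N.basic basic_clauses.intros)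
  have "quantitative_theory G ?\<Sigma>M X Th"
  proof (rule quantitative_theoryI)
    show "c \<in> Th" if "c \<in> basic_clauses G ?\<Sigma>M X" for c
      using that basic_Th M.in_horn_clauses[OF M.basic] by (cases c) (auto simp: Th_def)
    show "map_horn (subst \<sigma>) c \<in> Th" if "c \<in> Th" "\<sigma> \<in> X \<rightarrow> terms ?\<Sigma>M X" for c \<sigma>
    proof -
      have "map_horn (subst \<sigma>) c \<in> horn_clauses ?\<Sigma>M X"
        by (rule map_horn_in_horn_clauses) (use that subst_in_terms in \<open>auto simp: Th_def\<close>)
      \<comment> \<open>The interpretation of a \<sigma>-instance is the
        \<open>?I \<circ> \<sigma>\<close>-instance of the interpretation, so closure under Sub is
        inherited from the theory of \<open>N\<close>.\<close>
      moreover have "?I \<circ> \<sigma> \<in> X \<rightarrow> terms ?\<Sigma>N X" using that(2) by (auto intro!: I_terms)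
      then have "map_horn (subst (?I \<circ> \<sigma>)) (map_horn ?I c) \<in> theory_of G \<Sigma> X S N"
        using that(1) by (intro N.substitution) (auto simp: Th_def)
      moreover have "subst (?I \<circ> \<sigma>) \<circ> ?I = ?I \<circ> subst \<sigma>"
        by (rule ext) (simp add: interpret_constants_subst)
      ultimately show ?thesis by (simp add: Th_def map_horn_comp)
    qed
    show "(\<Gamma>, \<psi>) \<in> Th"
      if \<Gamma>: "\<Gamma> \<subseteq> equations ?\<Sigma>M X" "\<And>\<phi>. \<phi> \<in> \<Gamma>' \<Longrightarrow> (\<Gamma>, \<phi>) \<in> Th" "(\<Gamma>', \<psi>) \<in> Th" for \<Gamma> \<Gamma>' \<psi>
    proof -
      have "(map_eqn ?I ` \<Gamma>, map_eqn ?I \<psi>) \<in> theory_of G \<Sigma> X S N"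
      proof (rule N.cut)
        show "map_eqn ?I ` \<Gamma> \<subseteq> equations ?\<Sigma>N X" by (rule I_equations[OF \<Gamma>(1)])
        show "(map_eqn ?I ` \<Gamma>', map_eqn ?I \<psi>) \<in> theory_of G \<Sigma> X S N"
          using \<Gamma>(3) by (simp add: Th_def map_horn_def)
      qed (use \<Gamma>(2) in \<open>auto simp: Th_def map_horn_def\<close>)
      then show ?thesis using \<Gamma>(1,3) by (simp add: Th_def map_horn_def horn_clauses_iff)
    qed
    show "(\<Gamma>, \<phi>) \<in> Th" if \<Gamma>: "\<Gamma> \<subseteq> equations ?\<Sigma>M X" "\<phi> \<in> \<Gamma>" for \<Gamma> \<phi>
    proof -
      have "(map_eqn ?I ` \<Gamma>, map_eqn ?I \<phi>) \<in> theory_of G \<Sigma> X S N"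
        using \<Gamma>(2) by (intro quantitative_theory_hyp[OF N.is_theory I_equations[OF \<Gamma>(1)]]) simp
      then show ?thesis using \<Gamma> by (auto simp: Th_def map_horn_def horn_clauses_iff)
    qed
  qed (simp add: Th_def)
  moreover have "map_horn (map_tm Inl id) c \<in> Th" if "c \<in> S" for c
  proof -
    have "map_horn ?I (map_horn (map_tm Inl id) c) = map_horn (map_tm Inl id) c"
      by (simp add: map_horn_comp comp_def interpret_constants_map_tm_Inl)
    then show ?thesis
      using theory_of_clause[OF that, of N] M.in_horn_clauses[OF theory_of_clause[OF that]]
      by (simp add: Th_def)
  qed
  \<comment> \<open>The distance clauses of \<open>M\<close> are translated into exactly the
    provability condition of \<open>interpretation_of\<close>.\<close>
  moreover have "({}, QEq (snd M a a') (Fn (Inr a) []) (Fn (Inr a') [])) \<in> Th"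
    if "a \<in> fst M" "a' \<in> fst M" for a a'
    using theory_of_dist[OF that] M.in_horn_clauses k that
    by (simp add: Th_def map_horn_def interpretation_of_def)
  ultimately have "theory_of G \<Sigma> X S M \<subseteq> Th"
    unfolding theory_of_def by (intro least_theory_least) blast+
  then show ?thesis using c by (auto simp: Th_def)
qed

lemma interpret_ground:
  assumes "M \<in> GMet G" "N \<in> GMet G" "interpretation_of M N k"
  shows "({}, Eq (ground s) (ground t)) \<in> theory_of G \<Sigma> X S M \<Longrightarrow>
      ({}, Eq (ground (subst k s)) (ground (subst k t))) \<in> theory_of G \<Sigma> X S N"
    and "({}, QEq \<epsilon> (ground s) (ground t)) \<in> theory_of G \<Sigma> X S M \<Longrightarrow>
      ({}, QEq \<epsilon> (ground (subst k s)) (ground (subst k t))) \<in> theory_of G \<Sigma> X S N"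
  using interpret_constants_theory[OF assms]
  by (fastforce simp: map_horn_def interpret_constants_ground)+

section \<open>Classes of terms and their distances\<close>

abbreviation provable_eq :: "'a fuzzy \<Rightarrow> ('op, 'a) tm \<Rightarrow> ('op, 'a) tm \<Rightarrow> bool" where
  "provable_eq M s t \<equiv> ({}, Eq (ground s) (ground t)) \<in> theory_of G \<Sigma> X S M"

abbreviation provable_within :: "'a fuzzy \<Rightarrow> real \<Rightarrow> ('op, 'a) tm \<Rightarrow> ('op, 'a) tm \<Rightarrow> bool" where
  "provable_within M \<epsilon> s t \<equiv> ({}, QEq \<epsilon> (ground s) (ground t)) \<in> theory_of G \<Sigma> X S M"

abbreviation cls :: "'a fuzzy \<Rightarrow> ('op, 'a) tm \<Rightarrow> ('op, 'a) tm set" where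
  "cls M \<equiv> term_class G \<Sigma> X S M"

abbreviation T :: "'a fuzzy \<Rightarrow> ('op, 'a) tm set fuzzy" where
  "T M \<equiv> T_obj G \<Sigma> X S M"

lemma equiv_term_equiv:
  assumes M: "M \<in> GMet G"
  shows "equiv (terms \<Sigma> (fst M)) (term_equiv G \<Sigma> X S M)"
proof -
  interpret M: quantitative_theory_rules G "add_constants G \<Sigma> (fst M)" X "theory_of G \<Sigma> X S M"
    by (rule theory_of_rules[OF M])
  show ?thesis
  proof (rule equivI)
    show "refl_on (terms \<Sigma> (fst M)) (term_equiv G \<Sigma> X S M)"
      by (auto simp: refl_on_def term_equiv_def intro: M.Eq_refl_rule ground_in_terms)
    show "sym (term_equiv G \<Sigma> X S M)"
      by (auto simp: sym_def term_equiv_def intro: M.Eq_sym_rule)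
    show "trans (term_equiv G \<Sigma> X S M)"
      by (auto simp: trans_def term_equiv_def intro: M.Eq_trans_rule)
  qed (auto simp: term_equiv_def)
qed

lemma cls_eq_iff:
  assumes "M \<in> GMet G" "s \<in> terms \<Sigma> (fst M)" "t \<in> terms \<Sigma> (fst M)"
  shows "cls M s = cls M t \<longleftrightarrow> provable_eq M s t"
  using eq_equiv_class_iff[OF equiv_term_equiv[OF assms(1)] assms(2,3)] assms(2,3)
  by (simp add: term_class_def term_equiv_def)

lemma mem_cls_iff:
  "t \<in> cls M s \<longleftrightarrow> s \<in> terms \<Sigma> (fst M) \<and> t \<in> terms \<Sigma> (fst M) \<and> provable_eq M s t"
  by (simp add: term_class_def term_equiv_def)

lemma cls_self: "M \<in> GMet G \<Longrightarrow> t \<in> terms \<Sigma> (fst M) \<Longrightarrow> t \<in> cls M t"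
  unfolding term_class_def by (rule equiv_class_self[OF equiv_term_equiv])

lemma fst_T: "fst (T M) = cls M ` terms \<Sigma> (fst M)"
  by (auto simp: T_obj_def term_class_def quotient_def)

text \<open>The clause \<open>Infi\<close> proves the infimum of all provable indices. Inserting 1
  changes nothing because \<open>Top\<close> already makes 1 provable, so this infimum is the
  distance itself.\<close>

lemma term_dist_attained:
  assumes M: "M \<in> GMet G" and s: "s \<in> terms \<Sigma> (fst M)" and t: "t \<in> terms \<Sigma> (fst M)"
  shows "provable_within M (term_dist G \<Sigma> X S M s t) s t"
proof -
  interpret M: quantitative_theory_rules G "add_constants G \<Sigma> (fst M)" X "theory_of G \<Sigma> X S M"
    by (rule theory_of_rules[OF M])
  let ?E = "{\<epsilon>. provable_within M \<epsilon> s t}"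
  have "provable_within M (Inf (insert 1 ?E)) s t"
    by (rule M.Infi_rule) (auto intro: ground_in_terms s t)
  moreover have "insert 1 ?E = ?E"
    using M.Top_rule[OF ground_in_terms[OF s] ground_in_terms[OF t]] by auto
  ultimately show ?thesis by (simp add: term_dist_def)
qed

lemma term_dist_le:
  assumes M: "M \<in> GMet G" and "provable_within M \<epsilon> s t"
  shows "term_dist G \<Sigma> X S M s t \<le> \<epsilon>"
  unfolding term_dist_def
proof (rule cInf_lower)
  interpret M: quantitative_theory_rules G "add_constants G \<Sigma> (fst M)" X "theory_of G \<Sigma> X S M"
    by (rule theory_of_rules[OF M])
  show "bdd_below {\<epsilon>. provable_within M \<epsilon> s t}"
    by (rule bdd_belowI[of _ 0]) (auto dest: M.QEq_index)
qed (use assms in simp)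

text \<open>The attained distance of \<open>s\<close> and \<open>t\<close> can be moved to
  \<open>s'\<close> and \<open>t'\<close> by \<open>Eq_left\<close> and \<open>Eq_right\<close>.
  Exchanging the roles of the two pairs gives the reverse inequality, hence independence of
  representatives.\<close>

lemma term_dist_cls_le:
  assumes M: "M \<in> GMet G" and s: "s' \<in> cls M s" and t: "t' \<in> cls M t"
  shows "term_dist G \<Sigma> X S M s' t' \<le> term_dist G \<Sigma> X S M s t"
proof -
  interpret M: quantitative_theory_rules G "add_constants G \<Sigma> (fst M)" X "theory_of G \<Sigma> X S M"
    by (rule theory_of_rules[OF M])
  have "provable_within M (term_dist G \<Sigma> X S M s t) s t"
    using s t by (intro term_dist_attained[OF M]) (auto simp: mem_cls_iff)
  then have "provable_within M (term_dist G \<Sigma> X S M s t) s' t'"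
    using s t by (auto simp: mem_cls_iff intro: M.Eq_left_rule M.Eq_right_rule)
  then show ?thesis by (rule term_dist_le[OF M])
qed

lemma mem_cls_sym: "M \<in> GMet G \<Longrightarrow> t \<in> cls M s \<Longrightarrow> s \<in> cls M t"
  using equiv_term_equiv[of M] by (auto simp: equiv_def term_class_def dest: symD)

lemma snd_T:
  assumes M: "M \<in> GMet G" and s: "s \<in> terms \<Sigma> (fst M)" and t: "t \<in> terms \<Sigma> (fst M)"
  shows "snd (T M) (cls M s) (cls M t) = term_dist G \<Sigma> X S M s t"
proof -
  have "{term_dist G \<Sigma> X S M s' t' | s' t'. s' \<in> cls M s \<and> t' \<in> cls M t} =
      {term_dist G \<Sigma> X S M s t}"
    using cls_self[OF M s] cls_self[OF M t] term_dist_cls_le[OF M] mem_cls_sym[OF M]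
    by (auto intro!: antisym)
  then show ?thesis by (simp add: T_obj_def)
qed

text \<open>Each axiom follows from the rule of the same name applied to attained distances; the
  conclusion of the rule bounds the distance from above by \<open>term_dist_le\<close>.\<close>

lemma T_in_GMet:
  assumes M: "M \<in> GMet G"
  shows "T M \<in> GMet G"
proof -
  interpret M: quantitative_theory_rules G "add_constants G \<Sigma> (fst M)" X "theory_of G \<Sigma> X S M"
    by (rule theory_of_rules[OF M])
  let ?d = "term_dist G \<Sigma> X S M"
  note att = term_dist_attained[OF M] and le = term_dist_le[OF M]
  have unit: "?d s t \<in> {0..1}" if "s \<in> terms \<Sigma> (fst M)" "t \<in> terms \<Sigma> (fst M)" for s t
    using att[OF that] by (rule M.QEq_index)
  have "?d s t = ?d t s" if "AxS \<in> G" "s \<in> terms \<Sigma> (fst M)" "t \<in> terms \<Sigma> (fst M)" for s t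
    by (rule antisym; rule le[OF M.Sym_rule[OF that(1) att]]) (use that in auto)
  moreover have "?d s s = 0" if "AxR \<in> G" "s \<in> terms \<Sigma> (fst M)" for s
    using le[OF M.Refl_rule[OF that(1) ground_in_terms[OF that(2)]]] unit[OF that(2,2)] by simp
  moreover have "cls M s = cls M t"
    if "AxI \<in> G" "s \<in> terms \<Sigma> (fst M)" "t \<in> terms \<Sigma> (fst M)" "?d s t = 0" for s t
    using M.Ident_rule[OF that(1)] att[OF that(2,3)] that by (simp add: cls_eq_iff[OF M])
  moreover have "?d s r \<le> ?d s t + ?d t r"
    if "AxT \<in> G" "s \<in> terms \<Sigma> (fst M)" "t \<in> terms \<Sigma> (fst M)" "r \<in> terms \<Sigma> (fst M)" for s t r
  proof (cases "?d s t + ?d t r \<le> 1")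
    case True
    then show ?thesis by (rule le[OF M.Tri_rule[OF that(1) att[OF that(2,3)] att[OF that(3,4)]]])
  next
    \<comment> \<open>\<open>Tri\<close> yields an equation only for sums up to 1. Beyond that the
      inequality holds because distances are at most 1.\<close>
    case False
    then show ?thesis using unit[OF that(2,4)] by simp
  qed
  moreover have "?d s r \<le> max (?d s t) (?d t r)"
    if "AxU \<in> G" "s \<in> terms \<Sigma> (fst M)" "t \<in> terms \<Sigma> (fst M)" "r \<in> terms \<Sigma> (fst M)" for s t r
    by (rule le[OF M.Ultra_rule[OF that(1) att[OF that(2,3)] att[OF that(3,4)]]])
  ultimately have "(fst (T M), snd (T M)) \<in> GMet G"
    unfolding GMet_def fst_T using unit by (simp add: snd_T[OF M])
  then show ?thesis by simp
qed

lemma snd_T_le: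
  assumes "M \<in> GMet G" "provable_within M \<epsilon> s t" "s \<in> terms \<Sigma> (fst M)" "t \<in> terms \<Sigma> (fst M)"
  shows "snd (T M) (cls M s) (cls M t) \<le> \<epsilon>"
  using assms by (simp add: snd_T term_dist_le)

lemma snd_T_attained:
  assumes "M \<in> GMet G" "s \<in> terms \<Sigma> (fst M)" "t \<in> terms \<Sigma> (fst M)"
  shows "provable_within M (snd (T M) (cls M s) (cls M t)) s t"
  using assms by (simp add: snd_T term_dist_attained)

section \<open>The monad\<close>

lemma nonexpansive_in: "nonexpansive M N f \<Longrightarrow> f \<in> fst M \<rightarrow> fst N"
  by (simp add: nonexpansive_def)

text \<open>The theory of \<open>N\<close> proves that the constants \<open>f a\<close> and
  \<open>f a'\<close> are within their distance in \<open>N\<close>; nonexpansiveness of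
  \<open>f\<close> and \<open>Up\<close> weaken this to their distance in \<open>M\<close>.\<close>

lemma interpretation_of_nonexpansive:
  assumes M: "M \<in> GMet G" and N: "N \<in> GMet G" and f: "nonexpansive M N f"
  shows "interpretation_of M N (Var \<circ> f)"
proof -
  interpret N: quantitative_theory_rules G "add_constants G \<Sigma> (fst N)" X "theory_of G \<Sigma> X S N"
    by (rule theory_of_rules[OF N])
  have fN: "f a \<in> fst N" if "a \<in> fst M" for a using f that by (auto simp: nonexpansive_def)
  have "provable_within N (snd M a a') (Var (f a)) (Var (f a'))"
    if "a \<in> fst M" "a' \<in> fst M" for a a'
  proof (rule N.Up_rule[OF theory_of_dist])
    show "snd N (f a) (f a') \<le> snd M a a'" using f that by (simp add: nonexpansive_def)
    show "snd M a a' \<le> 1" using M that by (auto simp: GMet_def)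
  qed (use fN that in auto)
  then show ?thesis using fN by (auto simp: interpretation_of_def terms_Var_iff)
qed

lemma T_map_cls:
  assumes M: "M \<in> GMet G" and N: "N \<in> GMet G" and f: "nonexpansive M N f"
    and t: "t \<in> terms \<Sigma> (fst M)"
  shows "T_map G \<Sigma> X S N f (cls M t) = cls N (map_tm id f t)"
proof -
  have "cls N (map_tm id f s) = cls N (map_tm id f t)" if "s \<in> cls M t" for s
  proof -
    have s: "s \<in> terms \<Sigma> (fst M)" and "provable_eq M s t"
      using mem_cls_sym[OF M that] by (simp_all add: mem_cls_iff)
    then have "provable_eq N (map_tm id f s) (map_tm id f t)"
      using interpret_ground(1)[OF M N interpretation_of_nonexpansive[OF M N f]]
      by (simp add: map_tm_eq_subst)
    then show ?thesis
      using cls_eq_iff[OF N] map_tm_in_terms[OF _ nonexpansive_in[OF f]] s t by blast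
  qed
  then have "{cls N (map_tm id f s) | s. s \<in> cls M t} = {cls N (map_tm id f t)}"
    using cls_self[OF M t] by blast
  then show ?thesis by (simp add: T_map_def)
qed

text \<open>The translation along \<open>f\<close> keeps indices. Applied to the attained distance
  of two terms, it gives an upper bound on the distance of their images.\<close>

lemma nonexpansive_T_map:
  assumes M: "M \<in> GMet G" and N: "N \<in> GMet G" and f: "nonexpansive M N f"
  shows "nonexpansive (T M) (T N) (T_map G \<Sigma> X S N f)"
proof -
  note f_terms = map_tm_in_terms[OF _ nonexpansive_in[OF f]]
  have "snd (T N) (cls N (map_tm id f s)) (cls N (map_tm id f t)) \<le> snd (T M) (cls M s) (cls M t)"
    if "s \<in> terms \<Sigma> (fst M)" "t \<in> terms \<Sigma> (fst M)" for s t
    using interpret_ground(2)[OF M N interpretation_of_nonexpansive[OF M N f]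
        snd_T_attained[OF M that]] f_terms that
    by (intro snd_T_le[OF N]) (simp_all add: map_tm_eq_subst)
  then show ?thesis
    by (auto simp: nonexpansive_def fst_T T_map_cls[OF M N f] intro!: imageI f_terms)
qed

text \<open>A morphism is represented by a total function of which only the values on the carrier
  count; this shows that \<open>T_map\<close> respects that convention.\<close>

lemma T_map_cong:
  assumes "\<And>a. a \<in> fst M \<Longrightarrow> f' a = f a" "P \<in> fst (T M)"
  shows "T_map G \<Sigma> X S N f' P = T_map G \<Sigma> X S N f P"
proof -
  have "map_tm id f' t = map_tm id f t" if "t \<in> P" for t
    using assms that by (intro map_tm_cong_terms[of t \<Sigma> "fst M"]) (auto simp: fst_T mem_cls_iff)
  then have "{cls N (map_tm id f' t) | t. t \<in> P} = {cls N (map_tm id f t) | t. t \<in> P}"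
    by auto metis
  then show ?thesis by (simp add: T_map_def)
qed

lemma nonexpansive_T_unit:
  assumes M: "M \<in> GMet G"
  shows "nonexpansive M (T M) (T_unit G \<Sigma> X S M)"
  using snd_T_le[OF M theory_of_dist]
  by (auto simp: nonexpansive_def T_unit_def fst_T terms_Var_iff)

section \<open>Representatives and flattening\<close>

lemma subst_provable_eq:
  assumes M: "M \<in> GMet G" and u: "u \<in> terms \<Sigma> V"
    and eq: "\<And>v. v \<in> V \<Longrightarrow> provable_eq M (\<sigma> v) (\<tau> v)"
  shows "provable_eq M (subst \<sigma> u) (subst \<tau> u)"
proof -
  interpret M: quantitative_theory_rules G "add_constants G \<Sigma> (fst M)" X "theory_of G \<Sigma> X S M"
    by (rule theory_of_rules[OF M])
  show ?thesis
    using u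
  proof induction
    case (Fn p ts)
    then show ?case by (auto intro!: M.Eq_cong_rule)
  qed (simp add: eq)
qed

definition rep :: "('op, 'a) tm set \<Rightarrow> ('op, 'a) tm" where
  "rep P = (SOME t. t \<in> P)"

lemma rep_cls: "M \<in> GMet G \<Longrightarrow> t \<in> terms \<Sigma> (fst M) \<Longrightarrow> rep (cls M t) \<in> cls M t"
  unfolding rep_def by (rule someI[of _ t]) (rule cls_self)

lemma cls_rep:
  assumes "M \<in> GMet G" "P \<in> fst (T M)"
  shows "rep P \<in> terms \<Sigma> (fst M)" "cls M (rep P) = P"
proof -
  obtain t where t: "t \<in> terms \<Sigma> (fst M)" "P = cls M t" using assms(2) by (auto simp: fst_T)
  then have *: "rep P \<in> cls M t" using rep_cls[OF assms(1)] by simp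
  then show "rep P \<in> terms \<Sigma> (fst M)" by (simp add: mem_cls_iff)
  then show "cls M (rep P) = P" using * t cls_eq_iff[OF assms(1)] by (metis mem_cls_iff)
qed

text \<open>Here attainment of the infimum is essential: the representatives must be provably within
  the exact distance of their classes, not merely within every larger index.\<close>

lemma interpretation_of_rep:
  assumes M: "M \<in> GMet G"
  shows "interpretation_of (T M) M rep"
  unfolding interpretation_of_def
proof (intro conjI ballI Pi_I)
  fix P Q assume "P \<in> fst (T M)" "Q \<in> fst (T M)"
  then show "provable_within M (snd (T M) P Q) (rep P) (rep Q)"
    using snd_T_attained[OF M, of "rep P" "rep Q"] cls_rep[OF M] by simp
qed (rule cls_rep[OF M])

text \<open>The leaf \<open>t\<close> and the representative of its class are provably equal. By
  congruence, flattening with the chosen representatives agrees with flattening the given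
  leaves.\<close>

lemma subst_rep_provable_eq:
  assumes M: "M \<in> GMet G" and u: "u \<in> terms \<Sigma> (terms \<Sigma> (fst M))"
  shows "provable_eq M (subst rep (map_tm id (cls M) u)) (subst id u)"
  unfolding subst_map_tm
proof (rule subst_provable_eq[OF M u])
  show "provable_eq M ((rep \<circ> cls M) t) (id t)" if "t \<in> terms \<Sigma> (fst M)" for t
    using mem_cls_sym[OF M rep_cls[OF M that]] by (simp add: mem_cls_iff)
qed

text \<open>Translating along \<open>rep\<close> turns provability over the term space into
  provability over \<open>M\<close>; \<open>subst_rep_provable_eq\<close> then restores the original
  leaves. This is the well-definedness of the multiplication.\<close>

lemma flatten_provable_eq:
  assumes M: "M \<in> GMet G" and u: "u \<in> terms \<Sigma> (terms \<Sigma> (fst M))"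
    and v: "v \<in> terms \<Sigma> (terms \<Sigma> (fst M))"
    and eq: "provable_eq (T M) (map_tm id (cls M) u) (map_tm id (cls M) v)"
  shows "provable_eq M (subst id u) (subst id v)"
proof -
  interpret M: quantitative_theory_rules G "add_constants G \<Sigma> (fst M)" X "theory_of G \<Sigma> X S M"
    by (rule theory_of_rules[OF M])
  show ?thesis
    using interpret_ground(1)[OF T_in_GMet[OF M] M interpretation_of_rep[OF M] eq]
      subst_rep_provable_eq[OF M u] subst_rep_provable_eq[OF M v]
    by (blast intro: M.Eq_trans_rule M.Eq_sym_rule)
qed

text \<open>The same translation for quantitative equations. Since the index is unchanged, it yields
  nonexpansiveness of the multiplication.\<close>

lemma flatten_provable_within:
  assumes M: "M \<in> GMet G" and u: "u \<in> terms \<Sigma> (terms \<Sigma> (fst M))"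
    and v: "v \<in> terms \<Sigma> (terms \<Sigma> (fst M))"
    and eq: "provable_within (T M) \<epsilon> (map_tm id (cls M) u) (map_tm id (cls M) v)"
  shows "provable_within M \<epsilon> (subst id u) (subst id v)"
proof -
  interpret M: quantitative_theory_rules G "add_constants G \<Sigma> (fst M)" X "theory_of G \<Sigma> X S M"
    by (rule theory_of_rules[OF M])
  show ?thesis
    using interpret_ground(2)[OF T_in_GMet[OF M] M interpretation_of_rep[OF M] eq]
      subst_rep_provable_eq[OF M u] subst_rep_provable_eq[OF M v]
    by (blast intro: M.Eq_left_rule M.Eq_right_rule)
qed

lemma map_cls_in_terms:
  "u \<in> terms \<Sigma> (terms \<Sigma> (fst M)) \<Longrightarrow> map_tm id (cls M) u \<in> terms \<Sigma> (fst (T M))"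
  by (rule map_tm_in_terms) (auto simp: fst_T)

lemma T_mult_cls:
  assumes M: "M \<in> GMet G" and u: "u \<in> terms \<Sigma> (terms \<Sigma> (fst M))"
  shows "T_mult G \<Sigma> X S M (cls (T M) (map_tm id (cls M) u)) = cls M (subst id u)"
proof -
  have "cls M (subst id v) = cls M (subst id u)"
    if v: "v \<in> terms \<Sigma> (terms \<Sigma> (fst M))"
      and "map_tm id (cls M) v \<in> cls (T M) (map_tm id (cls M) u)" for v
    using flatten_provable_eq[OF M u v] that flatten_in_terms[OF u] flatten_in_terms[OF v]
    by (metis mem_cls_iff cls_eq_iff[OF M])
  moreover have "map_tm id (cls M) u \<in> cls (T M) (map_tm id (cls M) u)"
    by (rule cls_self[OF T_in_GMet[OF M] map_cls_in_terms[OF u]])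
  ultimately have "{cls M (subst id v) | v. v \<in> terms \<Sigma> (terms \<Sigma> (fst M)) \<and>
      map_tm id (cls M) v \<in> cls (T M) (map_tm id (cls M) u)} = {cls M (subst id u)}"
    using u by blast
  then show ?thesis by (simp add: T_mult_def)
qed

text \<open>Puts every point of the iterated term space into the form on which
  \<open>T_mult_cls\<close> computes.\<close>

lemma fst_TT:
  "fst (T (T M)) = (\<lambda>u. cls (T M) (map_tm id (cls M) u)) ` terms \<Sigma> (terms \<Sigma> (fst M))"
  by (simp add: fst_T[of "T M"] fst_T[of M] terms_image image_image)

lemma nonexpansive_T_mult:
  assumes M: "M \<in> GMet G"
  shows "nonexpansive (T (T M)) (T M) (T_mult G \<Sigma> X S M)"
proof -
  have "snd (T M) (cls M (subst id u)) (cls M (subst id v)) \<le>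
      snd (T (T M)) (cls (T M) (map_tm id (cls M) u)) (cls (T M) (map_tm id (cls M) v))"
    if u: "u \<in> terms \<Sigma> (terms \<Sigma> (fst M))" and v: "v \<in> terms \<Sigma> (terms \<Sigma> (fst M))" for u v
    by (rule snd_T_le[OF M flatten_provable_within[OF M u v snd_T_attained[OF T_in_GMet[OF M]]]])
      (simp_all add: map_cls_in_terms flatten_in_terms u v)
  then show ?thesis
    by (auto simp: nonexpansive_def fst_TT T_mult_cls[OF M]) (auto simp: fst_T flatten_in_terms)
qed

section \<open>Functoriality, naturality and the monad laws\<close>

lemma T_map_id:
  assumes "M \<in> GMet G" "P \<in> fst (T M)"
  shows "T_map G \<Sigma> X S M id P = P"
  using assms by (auto simp: fst_T T_map_cls nonexpansive_def tm.map_id)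

lemma T_map_comp:
  assumes "M \<in> GMet G" "N \<in> GMet G" "K \<in> GMet G" "nonexpansive M N f" "nonexpansive N K g"
    and "P \<in> fst (T M)"
  shows "T_map G \<Sigma> X S K (g \<circ> f) P = T_map G \<Sigma> X S K g (T_map G \<Sigma> X S N f P)"
proof -
  obtain t where t: "t \<in> terms \<Sigma> (fst M)" "P = cls M t" using assms(6) by (auto simp: fst_T)
  have "snd K (g (f a)) (g (f a')) \<le> snd M a a'" if "a \<in> fst M" "a' \<in> fst M" for a a'
  proof -
    have "f a \<in> fst N" "f a' \<in> fst N" using nonexpansive_in[OF assms(4)] that by auto
    then have "snd K (g (f a)) (g (f a')) \<le> snd N (f a) (f a')"
      using assms(5) by (simp add: nonexpansive_def)
    also have "\<dots> \<le> snd M a a'" using assms(4) that by (simp add: nonexpansive_def)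
    finally show ?thesis .
  qed
  then have "nonexpansive M K (g \<circ> f)"
    using nonexpansive_in[OF assms(4)] nonexpansive_in[OF assms(5)] by (auto simp: nonexpansive_def)
  then show ?thesis
    using assms t map_tm_in_terms[OF t(1) nonexpansive_in[OF assms(4)]]
    by (simp add: T_map_cls[where M = M] T_map_cls[where M = N] tm.map_comp)
qed

lemma T_unit_natural:
  assumes "M \<in> GMet G" "N \<in> GMet G" "nonexpansive M N f" "a \<in> fst M"
  shows "T_map G \<Sigma> X S N f (T_unit G \<Sigma> X S M a) = T_unit G \<Sigma> X S N (f a)"
  using assms by (simp add: T_unit_def T_map_cls terms_Var_iff)

lemma T_mult_natural:
  assumes M: "M \<in> GMet G" and N: "N \<in> GMet G" and f: "nonexpansive M N f"
    and P: "P \<in> fst (T (T M))"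
  shows "T_map G \<Sigma> X S N f (T_mult G \<Sigma> X S M P) =
    T_mult G \<Sigma> X S N (T_map G \<Sigma> X S (T N) (T_map G \<Sigma> X S N f) P)"
proof -
  obtain u where u: "u \<in> terms \<Sigma> (terms \<Sigma> (fst M))" and P_eq: "P = cls (T M) (map_tm id (cls M) u)"
    using P by (auto simp: fst_TT)
  note f_terms = map_tm_in_terms[OF _ nonexpansive_in[OF f]]
  have "T_map G \<Sigma> X S (T N) (T_map G \<Sigma> X S N f) P =
      cls (T N) (map_tm id (T_map G \<Sigma> X S N f \<circ> cls M) u)"
    using T_map_cls[OF T_in_GMet[OF M] T_in_GMet[OF N] nonexpansive_T_map[OF M N f]
        map_cls_in_terms[OF u]]
    by (simp add: P_eq tm.map_comp)
  \<comment> \<open>On the leaves of \<open>u\<close>, which are terms over \<open>M\<close>, acting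
    by \<open>f\<close> on the class is the same as renaming the representative and then taking its
    class.\<close>
  also have "map_tm id (T_map G \<Sigma> X S N f \<circ> cls M) u = map_tm id (cls N) (map_tm id (map_tm id f) u)"
    unfolding tm.map_comp id_comp
    by (rule map_tm_cong_terms[OF u]) (simp add: T_map_cls[OF M N f])
  also have "T_mult G \<Sigma> X S N (cls (T N) \<dots>) = cls N (subst id (map_tm id (map_tm id f) u))"
    by (rule T_mult_cls[OF N map_tm_in_terms[OF u]]) (auto intro: f_terms)
  also have "subst id (map_tm id (map_tm id f) u) = map_tm id f (subst id u)"
    by (simp add: subst_map_tm map_tm_subst)
  also have "cls N \<dots> = T_map G \<Sigma> X S N f (T_mult G \<Sigma> X S M P)"
    by (simp add: P_eq T_mult_cls[OF M u] T_map_cls[OF M N f flatten_in_terms[OF u]])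
  finally show ?thesis ..
qed

text \<open>The point in question is the class of a single leaf \<open>Var t\<close>, whose
  flattening is \<open>t\<close>.\<close>

lemma T_mult_unit:
  assumes M: "M \<in> GMet G" and P: "P \<in> fst (T M)"
  shows "T_mult G \<Sigma> X S M (T_unit G \<Sigma> X S (T M) P) = P"
proof -
  obtain t where t: "t \<in> terms \<Sigma> (fst M)" "P = cls M t" using P by (auto simp: fst_T)
  then show ?thesis
    using T_mult_cls[OF M, of "Var t"] by (simp add: T_unit_def terms_Var_iff)
qed

lemma T_mult_map_unit:
  assumes M: "M \<in> GMet G" and P: "P \<in> fst (T M)"
  shows "T_mult G \<Sigma> X S M (T_map G \<Sigma> X S (T M) (T_unit G \<Sigma> X S M) P) = P"
proof -
  obtain t where t: "t \<in> terms \<Sigma> (fst M)" and P_eq: "P = cls M t" using P by (auto simp: fst_T)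
  have "T_map G \<Sigma> X S (T M) (T_unit G \<Sigma> X S M) P = cls (T M) (map_tm id (T_unit G \<Sigma> X S M) t)"
    unfolding P_eq by (rule T_map_cls[OF M T_in_GMet[OF M] nonexpansive_T_unit[OF M] t])
  \<comment> \<open>The unit sends \<open>a\<close> to the class of \<open>Var a\<close>, so
    \<open>map_tm id Var t\<close> is the term of terms that records the representatives; its
    flattening is \<open>t\<close> again.\<close>
  also have "map_tm id (T_unit G \<Sigma> X S M) t = map_tm id (cls M) (map_tm id Var t)"
    by (simp add: tm.map_comp comp_def id_def T_unit_def[abs_def])
  also have "T_mult G \<Sigma> X S M (cls (T M) \<dots>) = cls M (subst id (map_tm id Var t))"
    by (rule T_mult_cls[OF M map_tm_in_terms[OF t]]) (auto intro: terms.Var)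
  also have "\<dots> = P" by (simp add: P_eq subst_map_tm subst_Var)
  finally show ?thesis .
qed

text \<open>On representatives, the left side flattens the two inner levels of a three-level term
  first and the right side the two outer ones. The results agree by
  \<open>subst_subst\<close>.\<close>

lemma T_mult_assoc:
  assumes M: "M \<in> GMet G" and P: "P \<in> fst (T (T (T M)))"
  shows "T_mult G \<Sigma> X S M (T_map G \<Sigma> X S (T M) (T_mult G \<Sigma> X S M) P) =
    T_mult G \<Sigma> X S M (T_mult G \<Sigma> X S (T M) P)"
proof -
  let ?A = "terms \<Sigma> (fst M)"
  note TM = T_in_GMet[OF M] and TTM = T_in_GMet[OF T_in_GMet[OF M]]
  let ?c = "\<lambda>u. cls (T M) (map_tm id (cls M) u)"
  \<comment> \<open>\<open>?c\<close> sends a term of terms to its point in the twofold term space,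
    so \<open>w\<close> records representatives at both inner levels.\<close>
  obtain w where w: "w \<in> terms \<Sigma> (terms \<Sigma> ?A)" and P_eq: "P = cls (T (T M)) (map_tm id ?c w)"
    using P unfolding fst_T[of "T (T M)"] fst_TT[of M] terms_image by blast
  have wT: "map_tm id ?c w \<in> terms \<Sigma> (fst (T (T M)))"
    by (rule map_tm_in_terms[OF w]) (auto simp: fst_TT)
  have flat_w: "map_tm id (subst id) w \<in> terms \<Sigma> ?A"
    by (rule map_tm_in_terms[OF w]) (auto intro: flatten_in_terms)
  have "T_map G \<Sigma> X S (T M) (T_mult G \<Sigma> X S M) P =
      cls (T M) (map_tm id (T_mult G \<Sigma> X S M \<circ> ?c) w)"
    unfolding P_eq T_map_cls[OF TTM TM nonexpansive_T_mult[OF M] wT] by (simp add: tm.map_comp)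
  also have "map_tm id (T_mult G \<Sigma> X S M \<circ> ?c) w = map_tm id (cls M) (map_tm id (subst id) w)"
    unfolding tm.map_comp id_comp by (rule map_tm_cong_terms[OF w]) (simp add: T_mult_cls[OF M])
  finally have 1: "T_mult G \<Sigma> X S M (T_map G \<Sigma> X S (T M) (T_mult G \<Sigma> X S M) P) =
      cls M (subst id (map_tm id (subst id) w))"
    using T_mult_cls[OF M flat_w] by simp
  \<comment> \<open>Splitting \<open>?c\<close> into its two class maps brings \<open>P\<close> into
    the form required by \<open>T_mult_cls\<close> for the space \<open>T M\<close>.\<close>
  have "map_tm id ?c w = map_tm id (cls (T M)) (map_tm id (map_tm id (cls M)) w)"
    by (simp add: tm.map_comp comp_def id_def)
  moreover have "map_tm id (map_tm id (cls M)) w \<in> terms \<Sigma> (terms \<Sigma> (fst (T M)))"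
    by (rule map_tm_in_terms[OF w]) (auto intro: map_cls_in_terms)
  ultimately have "T_mult G \<Sigma> X S (T M) P = cls (T M) (subst id (map_tm id (map_tm id (cls M)) w))"
    using T_mult_cls[OF TM] by (simp add: P_eq)
  also have "subst id (map_tm id (map_tm id (cls M)) w) = map_tm id (cls M) (subst id w)"
    by (simp add: subst_map_tm map_tm_subst)
  finally have 2: "T_mult G \<Sigma> X S M (T_mult G \<Sigma> X S (T M) P) = cls M (subst id (subst id w))"
    using T_mult_cls[OF M flatten_in_terms[OF w]] by simp
  have "subst id (map_tm id (subst id) w) = subst id (subst id w)"
    by (simp add: subst_map_tm subst_subst)
  then show ?thesis by (simp add: 1 2)
qed

end

theorem theorem4p5:
  fixes G :: "gmet_axiom set"
    and \<Sigma> :: "('op, 'u) lsig"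
    and X :: "'u set"
    and S :: "('op, 'u) tm horn set"
  assumes "lifted_signature G \<Sigma>"
    and "countable X" and "infinite X"
    and "S \<subseteq> horn_clauses \<Sigma> X"
  shows
    "\<comment> \<open>the object part is well defined\<close>
     (\<forall>M :: 'a fuzzy \<in> GMet G.
        equiv (terms \<Sigma> (fst M)) (term_equiv G \<Sigma> X S M) \<and>
        (\<forall>s\<in>terms \<Sigma> (fst M). \<forall>t\<in>terms \<Sigma> (fst M).
           snd (T_obj G \<Sigma> X S M) (term_class G \<Sigma> X S M s) (term_class G \<Sigma> X S M t) =
           Inf {\<epsilon>. ({}, QEq \<epsilon> (ground s) (ground t)) \<in> theory_of G \<Sigma> X S M}) \<and>
        T_obj G \<Sigma> X S M \<in> GMet G) \<and>
     \<comment> \<open>the morphism part is well defined\<close>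
     (\<forall>M :: 'a fuzzy \<in> GMet G. \<forall>N :: 'b fuzzy \<in> GMet G. \<forall>f. nonexpansive M N f \<longrightarrow>
        (\<forall>t\<in>terms \<Sigma> (fst M).
           T_map G \<Sigma> X S N f (term_class G \<Sigma> X S M t) = term_class G \<Sigma> X S N (map_tm id f t)) \<and>
        nonexpansive (T_obj G \<Sigma> X S M) (T_obj G \<Sigma> X S N) (T_map G \<Sigma> X S N f) \<and>
        (\<forall>f'. (\<forall>a\<in>fst M. f' a = f a) \<longrightarrow>
           (\<forall>P\<in>fst (T_obj G \<Sigma> X S M). T_map G \<Sigma> X S N f' P = T_map G \<Sigma> X S N f P))) \<and>
     \<comment> \<open>functoriality\<close>
     (\<forall>M :: 'a fuzzy \<in> GMet G. \<forall>P\<in>fst (T_obj G \<Sigma> X S M). T_map G \<Sigma> X S M id P = P) \<and>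
     (\<forall>M :: 'a fuzzy \<in> GMet G. \<forall>N :: 'b fuzzy \<in> GMet G. \<forall>K :: 'c fuzzy \<in> GMet G. \<forall>f g.
        nonexpansive M N f \<longrightarrow> nonexpansive N K g \<longrightarrow>
        (\<forall>P\<in>fst (T_obj G \<Sigma> X S M).
           T_map G \<Sigma> X S K (g \<circ> f) P = T_map G \<Sigma> X S K g (T_map G \<Sigma> X S N f P))) \<and>
     \<comment> \<open>unit and multiplication are well-defined morphisms\<close>
     (\<forall>M :: 'a fuzzy \<in> GMet G. nonexpansive M (T_obj G \<Sigma> X S M) (T_unit G \<Sigma> X S M)) \<and>
     (\<forall>M :: 'a fuzzy \<in> GMet G.
        (\<forall>u\<in>terms \<Sigma> (terms \<Sigma> (fst M)).
           T_mult G \<Sigma> X S M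
             (term_class G \<Sigma> X S (T_obj G \<Sigma> X S M) (map_tm id (term_class G \<Sigma> X S M) u)) =
           term_class G \<Sigma> X S M (subst id u)) \<and>
        nonexpansive (T_obj G \<Sigma> X S (T_obj G \<Sigma> X S M)) (T_obj G \<Sigma> X S M) (T_mult G \<Sigma> X S M)) \<and>
     \<comment> \<open>naturality of unit and multiplication\<close>
     (\<forall>M :: 'a fuzzy \<in> GMet G. \<forall>N :: 'b fuzzy \<in> GMet G. \<forall>f. nonexpansive M N f \<longrightarrow>
        (\<forall>a\<in>fst M. T_map G \<Sigma> X S N f (T_unit G \<Sigma> X S M a) = T_unit G \<Sigma> X S N (f a))) \<and>
     (\<forall>M :: 'a fuzzy \<in> GMet G. \<forall>N :: 'b fuzzy \<in> GMet G. \<forall>f. nonexpansive M N f \<longrightarrow>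
        (\<forall>P\<in>fst (T_obj G \<Sigma> X S (T_obj G \<Sigma> X S M)).
           T_map G \<Sigma> X S N f (T_mult G \<Sigma> X S M P) =
           T_mult G \<Sigma> X S N (T_map G \<Sigma> X S (T_obj G \<Sigma> X S N) (T_map G \<Sigma> X S N f) P))) \<and>
     \<comment> \<open>unit laws and associativity\<close>
     (\<forall>M :: 'a fuzzy \<in> GMet G. \<forall>P\<in>fst (T_obj G \<Sigma> X S M).
        T_mult G \<Sigma> X S M (T_unit G \<Sigma> X S (T_obj G \<Sigma> X S M) P) = P \<and>
        T_mult G \<Sigma> X S M (T_map G \<Sigma> X S (T_obj G \<Sigma> X S M) (T_unit G \<Sigma> X S M) P) = P) \<and>
     (\<forall>M :: 'a fuzzy \<in> GMet G.
        \<forall>P\<in>fst (T_obj G \<Sigma> X S (T_obj G \<Sigma> X S (T_obj G \<Sigma> X S M))).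
          T_mult G \<Sigma> X S M (T_map G \<Sigma> X S (T_obj G \<Sigma> X S M) (T_mult G \<Sigma> X S M) P) =
          T_mult G \<Sigma> X S M (T_mult G \<Sigma> X S (T_obj G \<Sigma> X S M) P))"
proof -
  interpret lifted_horn_theory G \<Sigma> X S
    using assms by unfold_locales
  show ?thesis
    \<comment> \<open>Each conjunct is one of the lemmas above; \<open>bspec\<close> supplies the
      premise of \<open>T_map_cong\<close> that the two maps agree on the carrier.\<close>
    by (intro conjI ballI allI impI;
      (rule equiv_term_equiv snd_T[unfolded term_dist_def] T_in_GMet T_map_cls nonexpansive_T_map
        T_map_id T_map_comp nonexpansive_T_unit T_mult_cls nonexpansive_T_mult T_unit_natural
        T_mult_natural T_mult_unit T_mult_map_unit T_mult_assoc T_map_cong;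
       (assumption | erule (1) bspec)))
qed

end
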